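(* \textsc{Graph Motif} can be solved in $\mathcal{O}(3^{\ell}\cdot n)$ time if the input graph $G$ is a tree, where $n=|V|$ and $\ell=|V|-|M|$.
   Context: \textsc{Graph Motif} (GM): the input is a multiset $M$ built on a set $C$ of colors, an undirected graph $G=(V,E)$, and a coloring $\chi:V\to C$; the question is whether there is $S\subseteq V$ such that $G[S]$ is connected and there is a one-to-one mapping $f:S\to M$ (respecting multiplicities) with $f(v)=\chi(v)$ for all $v\in S$, i.e. the multiset of colors of $S$ equals $M$. $|M|$ is counted with multiplicity. *)

theory Defs
  imports "Graph_Theory.Graph_Theory" "HOL-Library.Multiset"
begin

section \<open>Graph Motif\<close>

text \<open>
  Undirected simple graphs are the symmetric loop-free digraphs of the locale \<open>pair_graph\<close>.
  The library's \<open>connected\<close> demands a nonempty vertex set. As \<open>S\<close> is finite, the multiset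
  equation says that the color multiset of \<open>S\<close> is exactly \<open>M\<close>.
\<close>

definition graph_motif :: "'v pair_pre_digraph \<Rightarrow> ('v \<Rightarrow> 'c) \<Rightarrow> 'c multiset \<Rightarrow> bool" where
  "graph_motif G \<chi> M \<longleftrightarrow>
     (\<exists>S. S \<subseteq> pverts G \<and> Digraph_Component.connected (with_proj G \<restriction> S)
        \<and> image_mset \<chi> (mset_set S) = M)"

text \<open>
  In a symmetric digraph every edge yields the directed cycle \<open>u, v, u\<close>, so the library's
  \<open>tree\<close> is not the undirected notion. The directed cycles with at least three arcs are
  exactly the (oriented) cycles of the undirected graph.
\<close>

definition undirected_tree :: "'v pair_pre_digraph \<Rightarrow> bool" where
  "undirected_tree G \<longleftrightarrow> pair_graph G \<and> Digraph_Component.connected (with_proj G)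
     \<and> \<not> (\<exists>p. pre_digraph.cycle (with_proj G) p \<and> length p \<ge> 3)"

section \<open>A word RAM\<close>

text \<open>
  Programs work on registers and on random-access arrays. A program mentions only finitely
  many of either, so with a constant-factor slowdown the arrays can be interleaved in a single
  memory. Every elementary operation and every test costs one time unit. There is no
  multiplication, and subtraction is truncated at 0.
\<close>

record state =
  reg :: "nat \<Rightarrow> nat"
  arr :: "nat \<Rightarrow> nat \<Rightarrow> nat"

datatype test = Lt nat nat | Le nat nat | Eq nat nat | Neq nat nat

datatype com =
    Skip
  | Const nat nat       \<comment> \<open>\<open>Const x k\<close>: register \<open>x := k\<close>\<close>
  | Copy nat nat        \<comment> \<open>\<open>Copy x y\<close>: \<open>x := y\<close>\<close>
  | Add nat nat nat     \<comment> \<open>\<open>Add x y z\<close>: \<open>x := y + z\<close>\<close>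
  | Sub nat nat nat     \<comment> \<open>\<open>Sub x y z\<close>: \<open>x := y - z\<close>\<close>
  | Load nat nat nat    \<comment> \<open>\<open>Load x a y\<close>: \<open>x := a[y]\<close>\<close>
  | Store nat nat nat   \<comment> \<open>\<open>Store a y x\<close>: \<open>a[y] := x\<close>\<close>
  | Seq com com
  | If test com com
  | While test com

fun holds :: "test \<Rightarrow> state \<Rightarrow> bool" where
  "holds (Lt x y) s \<longleftrightarrow> reg s x < reg s y"
| "holds (Le x y) s \<longleftrightarrow> reg s x \<le> reg s y"
| "holds (Eq x y) s \<longleftrightarrow> reg s x = reg s y"
| "holds (Neq x y) s \<longleftrightarrow> reg s x \<noteq> reg s y"

definition set_reg :: "nat \<Rightarrow> nat \<Rightarrow> state \<Rightarrow> state" where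
  "set_reg x v s = s\<lparr>reg := (reg s)(x := v)\<rparr>"

definition set_arr :: "nat \<Rightarrow> nat \<Rightarrow> nat \<Rightarrow> state \<Rightarrow> state" where
  "set_arr a i v s = s\<lparr>arr := (arr s)(a := (arr s a)(i := v))\<rparr>"

text \<open>
  \<open>exec w P s t s'\<close>: on a machine with \<open>w\<close>-bit words, \<open>P\<close> started in \<open>s\<close> halts after \<open>t\<close>
  steps in \<open>s'\<close>. An overflow gets stuck. Only \<open>Const\<close> and \<open>Add\<close> can exceed the largest word
  in the state, so all words, and with them all addresses, stay below \<open>2 ^ w\<close> if they do so
  initially.
\<close>

inductive exec :: "nat \<Rightarrow> com \<Rightarrow> state \<Rightarrow> nat \<Rightarrow> state \<Rightarrow> bool" for w :: nat where
  Skip: "exec w Skip s 1 s"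
| Const: "k < 2 ^ w \<Longrightarrow> exec w (Const x k) s 1 (set_reg x k s)"
| Copy: "exec w (Copy x y) s 1 (set_reg x (reg s y) s)"
| Add: "reg s y + reg s z < 2 ^ w \<Longrightarrow> exec w (Add x y z) s 1 (set_reg x (reg s y + reg s z) s)"
| Sub: "exec w (Sub x y z) s 1 (set_reg x (reg s y - reg s z) s)"
| Load: "exec w (Load x a y) s 1 (set_reg x (arr s a (reg s y)) s)"
| Store: "exec w (Store a y x) s 1 (set_arr a (reg s y) (reg s x) s)"
| Seq: "exec w P s t1 s1 \<Longrightarrow> exec w Q s1 t2 s2 \<Longrightarrow> exec w (Seq P Q) s (t1 + t2) s2"
| IfTrue: "holds b s \<Longrightarrow> exec w P s t s' \<Longrightarrow> exec w (If b P Q) s (1 + t) s'"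
| IfFalse: "\<not> holds b s \<Longrightarrow> exec w Q s t s' \<Longrightarrow> exec w (If b P Q) s (1 + t) s'"
| WhileFalse: "\<not> holds b s \<Longrightarrow> exec w (While b P) s 1 s"
| WhileTrue: "holds b s \<Longrightarrow> exec w P s t1 s1 \<Longrightarrow> exec w (While b P) s1 t2 s2
    \<Longrightarrow> exec w (While b P) s (1 + t1 + t2) s2"

lemma exec_deterministic:
  assumes "exec w P s t s'" and "exec w P s u s''"
  shows "t = u \<and> s' = s''"
  using assms
proof (induction arbitrary: u s'')
  case (Seq P s t1 s1 Q t2 s2)
  from Seq.prems obtain u1 r u2 where "exec w P s u1 r" "exec w Q r u2 s''" "u = u1 + u2"
    by (auto elim: exec.cases)
  with Seq.IH show ?case by blast
next
  case (WhileTrue b s P t1 s1 t2 s2)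
  from WhileTrue.prems WhileTrue.hyps(1) obtain u1 r u2 where
    "exec w P s u1 r" "exec w (While b P) r u2 s''" "u = 1 + u1 + u2"
    by (cases rule: exec.cases) auto
  with WhileTrue.IH show ?case by blast
qed (erule exec.cases; auto)+

section \<open>Instances as machine inputs\<close>

text \<open>
  The vertices are \<open>0, \<dots>, n - 1\<close> and the set \<open>C\<close> of colors is \<open>{0, \<dots>, q - 1}\<close>. The list \<open>es\<close>
  contains every undirected edge exactly once, in an arbitrary order and orientation, and
  \<open>ms\<close> lists the motif with multiplicities in an arbitrary order.
\<close>

definition gm_encoding ::
  "nat pair_pre_digraph \<Rightarrow> (nat \<Rightarrow> nat) \<Rightarrow> nat multiset \<Rightarrow> nat \<Rightarrow> nat \<Rightarrow> (nat \<times> nat) list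
    \<Rightarrow> nat list \<Rightarrow> bool" where
  "gm_encoding G \<chi> M n q es ms \<longleftrightarrow>
     pair_graph G \<and> pverts G = {..<n} \<and>
     \<chi> ` pverts G \<subseteq> {..<q} \<and> set_mset M \<subseteq> {..<q} \<and>
     distinct es \<and> set es \<inter> (set es)\<inverse> = {} \<and> parcs G = set es \<union> (set es)\<inverse> \<and>
     mset ms = M"

definition list_array :: "nat list \<Rightarrow> nat \<Rightarrow> nat" where
  "list_array xs i = (if i < length xs then xs ! i else 0)"

definition gm_input ::
  "(nat \<Rightarrow> nat) \<Rightarrow> nat \<Rightarrow> nat \<Rightarrow> (nat \<times> nat) list \<Rightarrow> nat list \<Rightarrow> state" where
  "gm_input \<chi> n q es ms =
     \<lparr>reg = list_array [n, length es, length ms, q],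
      arr = (\<lambda>_ _. 0)
        (0 := list_array (map fst es),
         1 := list_array (map snd es),
         2 := list_array (map \<chi> [0..<n]),
         3 := list_array ms)\<rparr>"

end

theory Submission
  imports Defs "HOL-Library.Nat_Bijection"
begin

text \<open>
  If the motif \<open>M\<close> is contained in the colors of \<open>V\<close>, the surplus is a list of \<open>l\<close> color tokens, and
  a solution deletes vertices whose colors are exactly the tokens. Repeatedly merge a leaf \<open>v\<close> into
  its neighbour \<open>u\<close>. Every surviving vertex \<open>r\<close> represents a bag of merged vertices and has, for every
  set \<open>m\<close> of tokens, three bits: can \<open>m\<close> be spent on deleting the whole bag, on deleting all but a
  connected part of the bag containing \<open>r\<close>, or on deleting all but an arbitrary connected part?
  As \<open>uv\<close> is the only edge between the two bags, the bits of the merged bag for \<open>m\<close> are a disjunction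
  over the splittings of \<open>m\<close> into two disjoint sets. There are \<open>3 ^ l\<close> pairs of disjoint token sets,
  so a merge costs \<open>O(3 ^ l)\<close>, and there are \<open>n - 1\<close> merges.

  No adjacency lists are needed to strip the leaves in linear time: for each vertex it suffices to keep
  its degree and the sum modulo \<open>n\<close> of its neighbours, which for a leaf is its only neighbour. After
  \<open>v\<close> is removed, only \<open>u\<close> can have become a leaf, and it is treated next.
\<close>

section \<open>Weakest preconditions with running time\<close>

text \<open>Three bits suffice because the edge \<open>uv\<close> alone joins the two bags: a
  connected kept part that meets both must contain \<open>u\<close> and \<open>v\<close>, so of each
  bag only the parts through its representative can still be extended. Deleting a whole bag is
  recorded separately, since the empty set is not connected.

  Tokens are distinguishable even if their colors agree. A multiset of spent colors thus becomes a
  subset of \<open>{..<L}\<close>, and hence a table address.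

  The machine has neither multiplication nor bit operations, so pairs of disjoint sets cannot be
  decoded cheaply from a counter. They are tabulated once, one token at a time, each token tripling
  the list; the cost is a geometric sum. Codes are premultiplied by the row stride, so that every
  later address is a sum.

  The time bound mentions neither the number of colors nor the size of the motif. Hence the motif is
  read only after its size has been compared with \<open>n\<close>, and the tables rely on memory
  that is initially zero.\<close>

definition wp :: "nat \<Rightarrow> com \<Rightarrow> (nat \<Rightarrow> state \<Rightarrow> bool) \<Rightarrow> state \<Rightarrow> bool" where
  "wp w P Q s \<longleftrightarrow> (\<exists>t s'. exec w P s t s' \<and> Q t s')"

lemma exec_iff:
  "exec w Skip s t s' \<longleftrightarrow> t = 1 \<and> s' = s"
  "exec w (Const x k) s t s' \<longleftrightarrow> t = 1 \<and> k < 2 ^ w \<and> s' = set_reg x k s"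
  "exec w (Copy x y) s t s' \<longleftrightarrow> t = 1 \<and> s' = set_reg x (reg s y) s"
  "exec w (Add x y z) s t s' \<longleftrightarrow>
     t = 1 \<and> reg s y + reg s z < 2 ^ w \<and> s' = set_reg x (reg s y + reg s z) s"
  "exec w (Sub x y z) s t s' \<longleftrightarrow> t = 1 \<and> s' = set_reg x (reg s y - reg s z) s"
  "exec w (Load x a y) s t s' \<longleftrightarrow> t = 1 \<and> s' = set_reg x (arr s a (reg s y)) s"
  "exec w (Store a y x) s t s' \<longleftrightarrow> t = 1 \<and> s' = set_arr a (reg s y) (reg s x) s"
  "exec w (If b P R) s t s' \<longleftrightarrow>
     (\<exists>u. t = 1 + u \<and> (if holds b s then exec w P s u s' else exec w R s u s'))"
  by (auto simp del: One_nat_def elim: exec.cases intro: exec.intros)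

lemma exec_Seq_iff:
  "exec w (Seq P R) s t s' \<longleftrightarrow>
     (\<exists>t1 s1 t2. t = t1 + t2 \<and> exec w P s t1 s1 \<and> exec w R s1 t2 s')"
proof
  assume "exec w (Seq P R) s t s'"
  then show "\<exists>t1 s1 t2. t = t1 + t2 \<and> exec w P s t1 s1 \<and> exec w R s1 t2 s'"
    by (cases rule: exec.cases) auto
qed (auto intro: exec.Seq)

lemma wp_simps [simp]:
  "wp w Skip Q s \<longleftrightarrow> Q 1 s"
  "wp w (Const x k) Q s \<longleftrightarrow> k < 2 ^ w \<and> Q 1 (set_reg x k s)"
  "wp w (Copy x y) Q s \<longleftrightarrow> Q 1 (set_reg x (reg s y) s)"
  "wp w (Add x y z) Q s \<longleftrightarrow> reg s y + reg s z < 2 ^ w \<and> Q 1 (set_reg x (reg s y + reg s z) s)"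
  "wp w (Sub x y z) Q s \<longleftrightarrow> Q 1 (set_reg x (reg s y - reg s z) s)"
  "wp w (Load x a y) Q s \<longleftrightarrow> Q 1 (set_reg x (arr s a (reg s y)) s)"
  "wp w (Store a y x) Q s \<longleftrightarrow> Q 1 (set_arr a (reg s y) (reg s x) s)"
  by (auto simp: wp_def exec_iff)

lemma wp_Seq [simp]: "wp w (Seq P R) Q s \<longleftrightarrow> wp w P (\<lambda>t. wp w R (\<lambda>u. Q (t + u))) s"
  unfolding wp_def exec_Seq_iff by blast

lemma wp_If [simp]:
  "wp w (If b P R) Q s \<longleftrightarrow>
    (if holds b s then wp w P (\<lambda>t. Q (1 + t)) s else wp w R (\<lambda>t. Q (1 + t)) s)"
  by (auto simp: wp_def exec_iff)

lemma wp_mono: "wp w P Q s \<Longrightarrow> (\<And>t s'. Q t s' \<Longrightarrow> Q' t s') \<Longrightarrow> wp w P Q' s"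
  unfolding wp_def by blast

lemma reg_set_reg [simp]: "reg (set_reg x v s) = (reg s)(x := v)"
  and arr_set_reg [simp]: "arr (set_reg x v s) = arr s"
  and reg_set_arr [simp]: "reg (set_arr a i v s) = reg s"
  and arr_set_arr [simp]: "arr (set_arr a i v s) = (arr s)(a := (arr s a)(i := v))"
  by (simp_all add: set_reg_def set_arr_def)

lemma set_reg_id [simp]: "set_reg x (reg s x) s = s"
  and set_arr_id [simp]: "set_arr a i (arr s a i) s = s"
  by (simp_all add: set_reg_def set_arr_def)

text \<open>A syntactic over-approximation: that a register survives a subprogram follows by
  simplification and need not be part of a loop invariant.\<close>

fun regs_written :: "com \<Rightarrow> nat set" where
  "regs_written Skip = {}"
| "regs_written (Const x k) = {x}"
| "regs_written (Copy x y) = {x}"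
| "regs_written (Add x y z) = {x}"
| "regs_written (Sub x y z) = {x}"
| "regs_written (Load x a y) = {x}"
| "regs_written (Store a y x) = {}"
| "regs_written (Seq P Q) = regs_written P \<union> regs_written Q"
| "regs_written (If b P Q) = regs_written P \<union> regs_written Q"
| "regs_written (While b P) = regs_written P"

fun arrs_written :: "com \<Rightarrow> nat set" where
  "arrs_written (Store a y x) = {a}"
| "arrs_written (Seq P Q) = arrs_written P \<union> arrs_written Q"
| "arrs_written (If b P Q) = arrs_written P \<union> arrs_written Q"
| "arrs_written (While b P) = arrs_written P"
| "arrs_written _ = {}"

definition frame :: "nat set \<Rightarrow> nat set \<Rightarrow> state \<Rightarrow> state \<Rightarrow> bool" where
  "frame X A s s' \<longleftrightarrow> (\<forall>x. x \<notin> X \<longrightarrow> reg s' x = reg s x) \<and> (\<forall>a. a \<notin> A \<longrightarrow> arr s' a = arr s a)"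

lemma frame_reg: "frame X A s s' \<Longrightarrow> x \<notin> X \<Longrightarrow> reg s' x = reg s x"
  and frame_arr: "frame X A s s' \<Longrightarrow> a \<notin> A \<Longrightarrow> arr s' a = arr s a"
  by (simp_all add: frame_def)

lemma exec_frame: "exec w P s t s' \<Longrightarrow> frame (regs_written P) (arrs_written P) s s'"
  unfolding frame_def by (induction rule: exec.induct) auto

lemma wp_frame:
  "wp w P Q s \<Longrightarrow> wp w P (\<lambda>t s'. Q t s' \<and> frame (regs_written P) (arrs_written P) s s') s"
  unfolding wp_def using exec_frame by blast

text \<open>Amortized analysis: \<open>pot\<close> pays for the loop and ensures its termination at the same time.\<close>

lemma wp_While:
  assumes "I s"
    and step: "\<And>s. I s \<Longrightarrow> holds b s \<Longrightarrow> wp w P (\<lambda>t s'. I s' \<and> t + 1 + pot s' \<le> pot s) s"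
  shows "wp w (While b P) (\<lambda>t s'. I s' \<and> \<not> holds b s' \<and> t + pot s' \<le> pot s + 1) s"
  using assms(1)
proof (induction "pot s" arbitrary: s rule: less_induct)
  case less
  show ?case
  proof (cases "holds b s")
    case False
    then have "exec w (While b P) s 1 s" by (rule exec.WhileFalse)
    then show ?thesis unfolding wp_def using less.prems False by (intro exI[of _ 1] exI[of _ s]) simp
  next
    case True
    from step[OF less.prems True] obtain t s' where 1: "exec w P s t s'" "I s'"
      "t + 1 + pot s' \<le> pot s" unfolding wp_def by blast
    from less.hyps[of s'] 1 obtain u s'' where 2: "exec w (While b P) s' u s''" "I s''"
      "\<not> holds b s''" "u + pot s'' \<le> pot s' + 1" unfolding wp_def by auto
    have "exec w (While b P) s (1 + t + u) s''" by (rule exec.WhileTrue[OF True 1(1) 2(1)])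
    then show ?thesis unfolding wp_def using 1 2 by (intro exI[of _ "1 + t + u"] exI[of _ s'']) simp
  qed
qed

text \<open>The register that holds the constant \<open>1\<close>. Register \<open>4\<close> is never written and stays \<open>0\<close>.\<close>

abbreviation (input) one :: nat where "one \<equiv> 5"
abbreviation (input) zero :: nat where "zero \<equiv> 4"

section \<open>Counting loops\<close>

definition For :: "nat \<Rightarrow> nat \<Rightarrow> com \<Rightarrow> com" where
  "For i n P = Seq (Const i 0) (While (Lt i n) (Seq P (Add i i one)))"

lemma regs_written_For [simp]: "regs_written (For i n P) = insert i (regs_written P)"
  and arrs_written_For [simp]: "arrs_written (For i n P) = arrs_written P"
  by (auto simp: For_def)

text \<open>The invariant is required after the counter has been advanced, and
  \<open>N < 2 ^ w\<close> lets the last increment, to \<open>N\<close>, succeed. Each round adds a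
  test and an increment to the body, hence \<open>T k + 2\<close>; the final \<open>2\<close> is the
  initialization and the failing test. As \<open>step\<close> and \<open>post\<close> receive the
  frame condition, an invariant only describes what the body changes.\<close>

lemma wp_For:
  assumes fresh: "i \<notin> regs_written P" "n \<notin> insert i (regs_written P)" "one \<notin> insert i (regs_written P)"
    and one: "reg s one = 1" and N: "reg s n = N" "N < 2 ^ w"
    and init: "J 0 (set_reg i 0 s)"
    and step: "\<And>k s'. k < N \<Longrightarrow> J k s' \<Longrightarrow> reg s' i = k
        \<Longrightarrow> frame (insert i (regs_written P)) (arrs_written P) s s'
        \<Longrightarrow> wp w P (\<lambda>t s''. t \<le> T k \<and> J (Suc k) (set_reg i (Suc k) s'')) s'"
    and post: "\<And>t s'. J N s' \<Longrightarrow> reg s' i = N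
        \<Longrightarrow> frame (insert i (regs_written P)) (arrs_written P) s s'
        \<Longrightarrow> t \<le> (\<Sum>k<N. T k + 2) + 2 \<Longrightarrow> Q t s'"
  shows "wp w (For i n P) Q s"
proof -
  let ?fr = "frame (insert i (regs_written P)) (arrs_written P)"
  define I where "I = (\<lambda>s'. reg s' i \<le> N \<and> J (reg s' i) s' \<and> ?fr s s')"
  define pot where "pot = (\<lambda>s' :: state. \<Sum>k\<in>{reg s' i..<N}. T k + 2)"
  let ?s0 = "set_reg i 0 s"
  have I0: "I ?s0" using init by (simp add: I_def frame_def)
  have "wp w (While (Lt i n) (Seq P (Add i i one)))
      (\<lambda>t s'. I s' \<and> \<not> holds (Lt i n) s' \<and> t + pot s' \<le> pot ?s0 + 1) ?s0"
  proof (rule wp_While[where I = I, OF I0])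
    fix s' assume I: "I s'" and h: "holds (Lt i n) s'"
    have fr: "?fr s s'" using I by (simp add: I_def)
    have n': "reg s' n = N" and one': "reg s' one = 1"
      using fresh fr one N by (auto simp: frame_def)
    let ?k = "reg s' i"
    have k: "?k < N" using h n' by simp
    have "wp w P (\<lambda>t s''. (t \<le> T ?k \<and> J (Suc ?k) (set_reg i (Suc ?k) s'')) \<and>
        frame (regs_written P) (arrs_written P) s' s'') s'"
      by (rule wp_frame[OF step[OF k _ refl fr]]) (use I in \<open>simp add: I_def\<close>)
    then show "wp w (Seq P (Add i i one)) (\<lambda>t s''. I s'' \<and> t + 1 + pot s'' \<le> pot s') s'"
      unfolding wp_Seq
    proof (rule wp_mono)
      fix t s''
      assume a: "(t \<le> T ?k \<and> J (Suc ?k) (set_reg i (Suc ?k) s'')) \<and>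
        frame (regs_written P) (arrs_written P) s' s''"
      have i'': "reg s'' i = ?k" and one'': "reg s'' one = 1"
        using a fresh one' by (auto simp: frame_def)
      have "?fr s (set_reg i (Suc ?k) s'')"
        using a fr by (auto simp: frame_def)
      moreover have "pot s' = T ?k + 2 + (\<Sum>k\<in>{Suc ?k..<N}. T k + 2)"
        unfolding pot_def by (rule sum.atLeast_Suc_lessThan[OF k])
      ultimately show "wp w (Add i i one) (\<lambda>u s''. I s'' \<and> t + u + 1 + pot s'' \<le> pot s') s''"
        using a i'' one'' k N by (simp add: I_def pot_def)
    qed
  qed
  then show ?thesis
    unfolding For_def wp_Seq wp_simps
  proof (intro conjI)
    assume W: "wp w (While (Lt i n) (Seq P (Add i i one)))
      (\<lambda>t s'. I s' \<and> \<not> holds (Lt i n) s' \<and> t + pot s' \<le> pot ?s0 + 1) ?s0"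
    show "wp w (While (Lt i n) (Seq P (Add i i one))) (\<lambda>u. Q (1 + u)) (set_reg i 0 s)"
    proof (rule wp_mono[OF W])
      fix t s' assume a: "I s' \<and> \<not> holds (Lt i n) s' \<and> t + pot s' \<le> pot ?s0 + 1"
      then have "reg s' n = N" using fresh N by (auto simp: frame_def I_def)
      then have "reg s' i = N" using a by (simp add: I_def)
      then show "Q (1 + t) s'"
        using a by (intro post) (simp_all add: I_def pot_def atLeast0LessThan)
    qed
  qed simp
qed

section \<open>Connectivity by cuts\<close>

text \<open>Connectivity without walks: a cut is enlarged or restricted by set operations, which is
  all that removing a leaf and gluing along a bridge need.\<close>

definition cut_connected :: "('a \<times> 'a) set \<Rightarrow> 'a set \<Rightarrow> bool" where
  "cut_connected E T \<longleftrightarrow>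
     T \<noteq> {} \<and> (\<forall>A\<subseteq>T. A \<noteq> {} \<longrightarrow> A \<noteq> T \<longrightarrow> (\<exists>x\<in>A. \<exists>y\<in>T - A. (x, y) \<in> E))"

lemma cut_connectedD:
  "cut_connected E T \<Longrightarrow> A \<subseteq> T \<Longrightarrow> A \<noteq> {} \<Longrightarrow> A \<noteq> T \<Longrightarrow> \<exists>x\<in>A. \<exists>y\<in>T - A. (x, y) \<in> E"
  unfolding cut_connected_def by blast

lemma cut_connected_singleton [simp]: "cut_connected E {v}"
  unfolding cut_connected_def by auto

text \<open>A walk that leaves \<open>A\<close> uses an edge out of \<open>A\<close>; conversely, if
  every cut is crossed, the vertices reachable from \<open>u\<close> cannot form a proper subset of
  \<open>S\<close>.\<close>

lemma connected_induce_iff: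
  assumes "pair_graph G"
  shows "Digraph_Component.connected (with_proj G \<restriction> S) \<longleftrightarrow> cut_connected (parcs G) S"
proof -
  interpret pair_graph G by fact
  have sym: "(u, v) \<in> parcs G \<longleftrightarrow> (v, u) \<in> parcs G" for u v
    using arcs_ends_symmetric[OF pair_sym_arcs] by auto
  let ?E = "{e \<in> parcs G. fst e \<in> S \<and> snd e \<in> S}"
  \<comment> \<open>The library symmetrizes the arcs before it tests reachability, which leaves a
    symmetric arc set unchanged.\<close>
  have E: "(\<Union>e\<in>?E. {(fst e, snd e), (snd e, fst e)}) = ?E"
    using sym by auto
  have conv: "Digraph_Component.connected (with_proj G \<restriction> S) \<longleftrightarrow>
     S \<noteq> {} \<and> (\<forall>u\<in>S. \<forall>v\<in>S. (u, v) \<in> rtrancl_on S ?E)"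
    unfolding connected_def strongly_connected_def reachable_def mk_symmetric_def
    using E by (simp add: induce_subgraph_def)
  show ?thesis
    unfolding conv
  proof (intro iffI conjI)
    assume a: "S \<noteq> {} \<and> (\<forall>u\<in>S. \<forall>v\<in>S. (u, v) \<in> rtrancl_on S ?E)"
    show "cut_connected (parcs G) S"
      unfolding cut_connected_def
    proof (intro conjI allI impI)
      fix A assume A: "A \<subseteq> S" "A \<noteq> {}" "A \<noteq> S"
      then obtain x y where xy: "x \<in> A" "y \<in> S - A" by blast
      show "\<exists>x\<in>A. \<exists>y\<in>S - A. (x, y) \<in> parcs G"
      proof (rule ccontr)
        assume no: "\<not> ?thesis"
        have "z \<in> A" if "(x, z) \<in> rtrancl_on S ?E" for z
          using that by (induction rule: rtrancl_on_induct) (use xy no in auto)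
        then show False using a A xy by blast
      qed
    qed (use a in simp)
  next
    assume c: "cut_connected (parcs G) S"
    then show "S \<noteq> {}" by (simp add: cut_connected_def)
    show "\<forall>u\<in>S. \<forall>v\<in>S. (u, v) \<in> rtrancl_on S ?E"
    proof (intro ballI, rule ccontr)
      fix u v assume uv: "u \<in> S" "v \<in> S" "(u, v) \<notin> rtrancl_on S ?E"
      let ?A = "{y \<in> S. (u, y) \<in> rtrancl_on S ?E}"
      have "?A \<noteq> {}" "?A \<noteq> S" using uv by auto
      with cut_connectedD[OF c, of ?A] obtain x y where
        "x \<in> S" "(u, x) \<in> rtrancl_on S ?E" "y \<in> S" "(u, y) \<notin> rtrancl_on S ?E" "(x, y) \<in> parcs G"
        by blast
      moreover then have "(u, y) \<in> rtrancl_on S ?E"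
        by (intro rtrancl_on_into_rtrancl_on[of u x S ?E y]) auto
      ultimately show False by simp
    qed
  qed
qed

lemma cut_connected_remove_leaf:
  assumes "cut_connected E R" and v: "v \<in> R" and u: "u \<in> R" "u \<noteq> v"
    and leaf: "{y \<in> R. (v, y) \<in> E} = {u}" and sym: "sym E"
  shows "cut_connected E (R - {v})"
  unfolding cut_connected_def
proof (intro conjI allI impI)
  show "R - {v} \<noteq> {}" using u by blast
next
  fix A assume A: "A \<subseteq> R - {v}" "A \<noteq> {}" "A \<noteq> R - {v}"
  \<comment> \<open>Putting \<open>v\<close> on the side of \<open>u\<close> keeps the leaf edge
    from crossing the cut, so the crossing edge found avoids \<open>v\<close>.\<close>
  define A' where "A' = (if u \<in> A then insert v A else A)"
  have "A' \<subseteq> R" "A' \<noteq> {}" "A' \<noteq> R" using A v u by (auto simp: A'_def)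
  then obtain x y where xy: "x \<in> A'" "y \<in> R - A'" "(x, y) \<in> E"
    using cut_connectedD[OF assms(1)] by blast
  have "(v, y) \<notin> E \<or> y = u" and "(v, x) \<notin> E \<or> x = u"
    using xy leaf \<open>A' \<subseteq> R\<close> by blast+
  then have "x \<noteq> v" "y \<noteq> v"
    using xy A u symD[OF sym xy(3)] by (auto simp: A'_def split: if_splits)
  then show "\<exists>x\<in>A. \<exists>y\<in>R - {v} - A. (x, y) \<in> E"
    using xy by (auto simp: A'_def split: if_splits)
qed

lemma cut_connected_bridge_part:
  assumes sym: "sym E" and disj: "S \<inter> T = {}" and S: "S \<noteq> {}"
    and bridge: "\<And>x y. x \<in> S \<Longrightarrow> y \<in> T \<Longrightarrow> (x, y) \<in> E \<Longrightarrow> x = u"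
    and c: "cut_connected E (S \<union> T)"
  shows "cut_connected E S"
  unfolding cut_connected_def
proof (intro conjI allI impI)
  fix A assume A: "A \<subseteq> S" "A \<noteq> {}" "A \<noteq> S"
  \<comment> \<open>\<open>T\<close> joins the side of \<open>u\<close>, the only vertex of
    \<open>S\<close> with edges into \<open>T\<close>; then no edge between \<open>S\<close> and
    \<open>T\<close> crosses the enlarged cut.\<close>
  define A' where "A' = (if u \<in> A then A \<union> T else A)"
  have "A' \<subseteq> S \<union> T" "A' \<noteq> {}" using A by (auto simp: A'_def)
  moreover obtain z where "z \<in> S" "z \<notin> A" using A by blast
  then have "z \<in> S \<union> T" "z \<notin> A'" using disj by (auto simp: A'_def)
  then have "A' \<noteq> S \<union> T" by blast
  ultimately obtain x y where xy: "x \<in> A'" "y \<in> S \<union> T - A'" "(x, y) \<in> E"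
    using cut_connectedD[OF c] by blast
  then have "(y, x) \<in> E" using sym by (simp add: symD)
  then show "\<exists>x\<in>A. \<exists>y\<in>S - A. (x, y) \<in> E"
    using xy A bridge[of x y] bridge[of y x] by (auto simp: A'_def split: if_splits)
qed (use S in simp)

text \<open>The cut between \<open>S\<close> and \<open>T\<close> can only be crossed by
  \<open>uv\<close>, which forces both ends to be kept. Conversely, a cut of the union either cuts
  one side properly or separates the two sides and is crossed by \<open>uv\<close>.\<close>

lemma cut_connected_bridge:
  assumes sym: "sym E" and disj: "B \<inter> C = {}" and uv: "(u, v) \<in> E"
    and bridge: "\<And>x y. x \<in> B \<Longrightarrow> y \<in> C \<Longrightarrow> (x, y) \<in> E \<Longrightarrow> x = u \<and> y = v"
    and S: "S \<subseteq> B" "S \<noteq> {}" and T: "T \<subseteq> C" "T \<noteq> {}"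
  shows "cut_connected E (S \<union> T) \<longleftrightarrow> u \<in> S \<and> v \<in> T \<and> cut_connected E S \<and> cut_connected E T"
proof
  assume c: "cut_connected E (S \<union> T)"
  have "S \<noteq> S \<union> T" using S T disj by blast
  with cut_connectedD[OF c, of S] S obtain x y where "x \<in> S" "y \<in> T" "(x, y) \<in> E" by blast
  then have in_parts: "u \<in> S" "v \<in> T" using bridge S T by blast+
  have "cut_connected E S"
    using S T disj bridge by (intro cut_connected_bridge_part[OF sym _ _ _ c, of u]) blast+
  moreover have "cut_connected E T"
    using S T disj bridge sym
    by (intro cut_connected_bridge_part[OF sym _ _ _ c[unfolded Un_commute[of S]], of v])
      (blast dest: symD)+
  ultimately show "u \<in> S \<and> v \<in> T \<and> cut_connected E S \<and> cut_connected E T"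
    using in_parts by simp
next
  assume c: "u \<in> S \<and> v \<in> T \<and> cut_connected E S \<and> cut_connected E T"
  show "cut_connected E (S \<union> T)"
    unfolding cut_connected_def
  proof (intro conjI allI impI)
    fix A assume A: "A \<subseteq> S \<union> T" "A \<noteq> {}" "A \<noteq> S \<union> T"
    have vu: "(v, u) \<in> E" using uv sym by (meson symD)
    consider "A \<inter> S \<noteq> {}" "A \<inter> S \<noteq> S" | "A \<inter> T \<noteq> {}" "A \<inter> T \<noteq> T" | "A = S" | "A = T"
      using A by blast
    then show "\<exists>x\<in>A. \<exists>y\<in>S \<union> T - A. (x, y) \<in> E"
    proof cases
      case 1
      then show ?thesis using cut_connectedD[of E S "A \<inter> S"] c by blast
    next
      case 2
      then show ?thesis using cut_connectedD[of E T "A \<inter> T"] c by blast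
    next
      case 3
      then show ?thesis using c uv disj S T by blast
    next
      case 4
      then show ?thesis using c uv vu disj S T by blast
    qed
  qed (use S in simp)
qed

section \<open>Leaves of acyclic graphs\<close>

text \<open>Cycles as closed vertex lists rather than arc walks, which suits the longest-path
  argument for leaves.\<close>

definition acyclic_graph :: "('a \<times> 'a) set \<Rightarrow> bool" where
  "acyclic_graph E \<longleftrightarrow> \<not> (\<exists>xs. distinct xs \<and> 3 \<le> length xs \<and>
     successively (\<lambda>x y. (x, y) \<in> E) xs \<and> (last xs, hd xs) \<in> E)"

lemma pcas_zip: "pcas x (zip (x # xs) (xs @ [y])) y"
  by (induction xs arbitrary: x) auto

lemma pawalk_verts_zip: "pawalk_verts x (zip (x # xs) (xs @ [y])) = x # xs @ [y]"
  by (induction xs arbitrary: x) auto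

lemma zip_subset_edges:
  "successively (\<lambda>x y. (x, y) \<in> E) (x # xs) \<Longrightarrow> (last (x # xs), y) \<in> E \<Longrightarrow>
   set (zip (x # xs) (xs @ [y])) \<subseteq> E"
  by (induction xs arbitrary: x) auto

text \<open>Pairing each vertex with its successor turns a closed vertex list into an arc walk with
  as many arcs as vertices.\<close>

lemma undirected_tree_acyclic:
  assumes "undirected_tree G" shows "acyclic_graph (parcs G)"
  unfolding acyclic_graph_def
proof
  from assms interpret pair_graph G by (simp add: undirected_tree_def)
  assume "\<exists>xs. distinct xs \<and> 3 \<le> length xs \<and>
     successively (\<lambda>x y. (x, y) \<in> parcs G) xs \<and> (last xs, hd xs) \<in> parcs G"
  then obtain x xs where xs: "distinct (x # xs)" "3 \<le> length (x # xs)"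
     "successively (\<lambda>x y. (x, y) \<in> parcs G) (x # xs)" "(last (x # xs), x) \<in> parcs G"
    by (metis list.sel(1) list.exhaust list.size(3) not_numeral_le_zero)
  let ?p = "zip (x # xs) (xs @ [x])"
  have "x \<in> pverts G" using xs(4) by (rule in_arcsD2)
  then have "awalk x ?p x"
    unfolding awalk_def using pcas_zip[of x xs x] zip_subset_edges[OF xs(3,4)] by simp
  then have "cycle ?p"
    unfolding cycle_def pawalk_verts_zip using xs(1) by (intro exI[of _ x]) (auto simp: pawalk_verts_zip simp del: zip_Cons_Cons)
  moreover have "3 \<le> length ?p" using xs(2) by simp
  ultimately show False using assms unfolding undirected_tree_def by blast
qed

text \<open>The end \<open>x\<close> of a longest path has all its neighbours on the path. A
  neighbour \<open>y\<close> other than the next vertex would close a cycle.\<close>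

lemma acyclic_graph_leaf:
  assumes "acyclic_graph E" "sym E" "irrefl E" and R: "finite R" "R \<noteq> {}"
  shows "\<exists>v\<in>R. card {y \<in> R. (v, y) \<in> E} \<le> 1"
proof (rule ccontr)
  assume no: "\<not> ?thesis"
  let ?P = "\<lambda>xs. xs \<noteq> [] \<and> distinct xs \<and> set xs \<subseteq> R \<and> successively (\<lambda>x y. (x, y) \<in> E) xs"
  obtain r where "r \<in> R" using R by blast
  then have P0: "?P [r]" by simp
  have "length xs < Suc (card R)" if "?P xs" for xs
    using that R by (metis card_mono distinct_card less_Suc_eq_le)
  with ex_has_greatest_nat[of ?P "[r]" length "Suc (card R)"] P0
  obtain xs where xs: "?P xs" and max: "\<And>ys. ?P ys \<Longrightarrow> length ys \<le> length xs"
    by blast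
  then obtain x rest where xr: "xs = x # rest" by (cases xs) auto
  let ?N = "{y \<in> R. (x, y) \<in> E}"
  have N: "?N \<subseteq> set rest"
  proof
    fix y assume y: "y \<in> ?N"
    then have "(y, x) \<in> E" "y \<noteq> x" using assms by (auto dest: symD simp: irrefl_def)
    show "y \<in> set rest"
    proof (rule ccontr)
      assume "y \<notin> set rest"
      then have "?P (y # xs)" using xs xr y \<open>(y, x) \<in> E\<close> \<open>y \<noteq> x\<close> by auto
      from max[OF this] show False by simp
    qed
  qed
  have "card ?N \<ge> 2" using no xs xr by (auto simp: not_le)
  then have "\<not> ?N \<subseteq> {hd rest}" using card_mono[of "{hd rest}" ?N] by auto
  then obtain y where y: "y \<in> ?N" "y \<noteq> hd rest" by blast
  with N obtain p q where pq: "rest = p @ y # q" by (metis split_list subsetD)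
  have p: "p \<noteq> []" using pq y by auto
  let ?c = "x # p @ [y]"
  have "xs = ?c @ q" using xr pq by simp
  then have c: "distinct ?c" "successively (\<lambda>x y. (x, y) \<in> E) ?c"
    using xs by (metis distinct_append, metis successively_append_iff)
  have "3 \<le> length ?c" using p by (cases p) auto
  moreover have "(last ?c, hd ?c) \<in> E" using y assms by (auto dest: symD)
  ultimately show False using assms(1) c unfolding acyclic_graph_def by blast
qed

text \<open>Deleting a vertex of degree at most one loses at most two arcs. Both orientations are
  counted, so there are at most as many undirected edges as vertices, which makes reading the edge
  list linear in \<open>n\<close>.\<close>

lemma acyclic_graph_card_edges:
  assumes "acyclic_graph E" "sym E" "irrefl E" "finite R"
  shows "card (E \<inter> R \<times> R) \<le> 2 * card R"
  using assms(4)
proof (induction "card R" arbitrary: R)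
  case 0
  then show ?case by simp
next
  case (Suc k)
  then obtain v where v: "v \<in> R" "card {y \<in> R. (v, y) \<in> E} \<le> 1"
    using acyclic_graph_leaf[OF assms(1-3)] by (metis card.empty nat.distinct(1))
  let ?N = "{y \<in> R. (v, y) \<in> E}"
  have IH: "card (E \<inter> (R - {v}) \<times> (R - {v})) \<le> 2 * card (R - {v})"
    using Suc v by (intro Suc.hyps(1)) auto
  have "E \<inter> R \<times> R \<subseteq> E \<inter> (R - {v}) \<times> (R - {v}) \<union> ({v} \<times> ?N \<union> ?N \<times> {v})"
    using assms(2) by (auto dest: symD)
  then have "card (E \<inter> R \<times> R) \<le> card (E \<inter> (R - {v}) \<times> (R - {v}) \<union> ({v} \<times> ?N \<union> ?N \<times> {v}))"
    using Suc by (intro card_mono) auto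
  also have "\<dots> \<le> card (E \<inter> (R - {v}) \<times> (R - {v})) + (card ({v} \<times> ?N) + card (?N \<times> {v}))"
    by (meson card_Un_le add_left_mono le_trans)
  also have "\<dots> \<le> 2 * card R"
    using IH v Suc.hyps(2) Suc.prems by (simp add: card_cartesian_product)
  finally show ?case .
qed

lemma cut_connected_acyclic_leaf:
  assumes "acyclic_graph E" "sym E" "irrefl E" and R: "finite R" "2 \<le> card R" "cut_connected E R"
  shows "\<exists>v\<in>R. card {y \<in> R. (v, y) \<in> E} = 1"
proof -
  have "R \<noteq> {}" using R by auto
  with acyclic_graph_leaf[OF assms(1-4)] obtain v
    where v: "v \<in> R" "card {y \<in> R. (v, y) \<in> E} \<le> 1" by blast
  have "{v} \<noteq> R" using R by auto
  with cut_connectedD[OF R(3), of "{v}"] v have "{y \<in> R. (v, y) \<in> E} \<noteq> {}" by auto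
  then have "card {y \<in> R. (v, y) \<in> E} \<noteq> 0" using R by simp
  then show ?thesis using v by (intro bexI[of _ v]) auto
qed

section \<open>Merging the tables of two subtrees\<close>

text \<open>\<open>tok i\<close> is the color of token \<open>i\<close>.\<close>

locale surplus_tokens =
  fixes E :: "(nat \<times> nat) set" and \<chi> :: "nat \<Rightarrow> nat" and tok :: "nat \<Rightarrow> nat"
begin

definition colors :: "nat set \<Rightarrow> nat multiset" where
  "colors S = image_mset \<chi> (mset_set S)"

definition tokens :: "nat set \<Rightarrow> nat multiset" where
  "tokens m = image_mset tok (mset_set m)"

definition none_kept :: "nat set \<Rightarrow> nat set \<Rightarrow> bool" where
  "none_kept B m \<longleftrightarrow> colors B = tokens m"

definition root_kept :: "nat set \<Rightarrow> nat \<Rightarrow> nat set \<Rightarrow> bool" where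
  "root_kept B r m \<longleftrightarrow> (\<exists>T\<subseteq>B. r \<in> T \<and> cut_connected E T \<and> colors (B - T) = tokens m)"

definition some_kept :: "nat set \<Rightarrow> nat set \<Rightarrow> bool" where
  "some_kept B m \<longleftrightarrow> (\<exists>T\<subseteq>B. cut_connected E T \<and> colors (B - T) = tokens m)"

lemma colors_Un: "finite S \<Longrightarrow> finite T \<Longrightarrow> S \<inter> T = {} \<Longrightarrow> colors (S \<union> T) = colors S + colors T"
  by (simp add: colors_def mset_set_Union)

lemma tokens_Un: "finite S \<Longrightarrow> finite T \<Longrightarrow> S \<inter> T = {} \<Longrightarrow> tokens (S \<union> T) = tokens S + tokens T"
  by (simp add: tokens_def mset_set_Union)

text \<open>A splitting of the colors lifts to one of the token set because
  \<open>mset_set m\<close> has no repetitions: its summands are again sets, and disjoint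
  ones.\<close>

lemma tokens_split:
  assumes "finite m"
  shows "P + Q = tokens m \<longleftrightarrow> (\<exists>a b. a \<union> b = m \<and> a \<inter> b = {} \<and> P = tokens a \<and> Q = tokens b)"
proof
  assume "P + Q = tokens m"
  then obtain A B where AB: "mset_set m = A + B" "P = image_mset tok A" "Q = image_mset tok B"
    unfolding tokens_def by (metis image_mset_eq_plusD)
  have cnt: "count A x + count B x = (if x \<in> m then 1 else 0)" for x
    using assms by (simp flip: AB(1) count_union add: count_mset_set')
  have part: "N = mset_set (set_mset N)" if "N = A \<or> N = B" for N
  proof (rule multiset_eqI)
    fix x
    have le: "count N x \<le> 1" using cnt[of x] that by (auto split: if_splits)
    show "count N x = count (mset_set (set_mset N)) x"
    proof (cases "count N x = 0")
      case True
      then show ?thesis by (simp add: count_eq_zero_iff)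
    next
      case False
      then have "x \<in># N" by (simp add: count_eq_zero_iff)
      moreover have "count N x = 1" using le False by linarith
      ultimately show ?thesis by simp
    qed
  qed
  have "set_mset A \<union> set_mset B = m"
    using arg_cong[OF AB(1), of set_mset] assms by simp
  moreover have "set_mset A \<inter> set_mset B = {}"
  proof (rule ccontr)
    assume "\<not> ?thesis"
    then obtain x where "x \<in># A" "x \<in># B" by blast
    then have "0 < count A x" "0 < count B x" by (simp_all only: count_greater_zero_iff)
    with cnt[of x] show False by (simp only: split: if_splits)
  qed
  moreover have "P = tokens (set_mset A)" "Q = tokens (set_mset B)"
    unfolding tokens_def AB(2,3) part[OF disjI1[OF refl], symmetric] part[OF disjI2[OF refl], symmetric]
    by (rule refl)+
  ultimately show "\<exists>a b. a \<union> b = m \<and> a \<inter> b = {} \<and> P = tokens a \<and> Q = tokens b"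
    by (intro exI[of _ "set_mset A"] exI[of _ "set_mset B"] conjI)
next
  assume "\<exists>a b. a \<union> b = m \<and> a \<inter> b = {} \<and> P = tokens a \<and> Q = tokens b"
  then obtain a b where ab: "a \<union> b = m" "a \<inter> b = {}" "P = tokens a" "Q = tokens b" by blast
  then show "P + Q = tokens m" using assms tokens_Un[of a b] by auto
qed

lemma none_kept_singleton:
  assumes "finite m" shows "none_kept {r} m \<longleftrightarrow> (\<exists>i. m = {i} \<and> tok i = \<chi> r)"
proof
  assume "none_kept {r} m"
  then have eq: "{#\<chi> r#} = image_mset tok (mset_set m)"
    by (simp add: none_kept_def colors_def tokens_def)
  then have "size (image_mset tok (mset_set m)) = 1" by (metis size_single)
  then have "card m = 1" by simp
  then obtain i where "m = {i}" by (metis card_1_singletonE)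
  with eq show "\<exists>i. m = {i} \<and> tok i = \<chi> r" by simp
qed (auto simp: none_kept_def colors_def tokens_def)

lemma tokens_eq_empty: "finite m \<Longrightarrow> tokens m = {#} \<longleftrightarrow> m = {}"
  by (simp add: tokens_def mset_set_empty_iff[of m])

lemma root_kept_singleton:
  assumes "finite m" shows "root_kept {r} r m \<longleftrightarrow> m = {}"
proof -
  have "r \<in> T \<and> T \<subseteq> {r} \<longleftrightarrow> T = {r}" for T by blast
  then have "root_kept {r} r m \<longleftrightarrow> colors {} = tokens m"
    unfolding root_kept_def by (metis Diff_cancel cut_connected_singleton)
  moreover have "colors {} = {#}" by (simp add: colors_def)
  ultimately show ?thesis using tokens_eq_empty[OF assms] by metis
qed

lemma some_kept_singleton:
  assumes "finite m" shows "some_kept {r} m \<longleftrightarrow> m = {}"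
proof -
  have "T \<subseteq> {r} \<and> cut_connected E T \<longleftrightarrow> r \<in> T \<and> T \<subseteq> {r} \<and> cut_connected E T" for T
    unfolding cut_connected_def by blast
  then have "some_kept {r} m \<longleftrightarrow> root_kept {r} r m"
    unfolding some_kept_def root_kept_def by metis
  then show ?thesis using root_kept_singleton[OF assms] by simp
qed

section \<open>Two bags joined by a single edge\<close>

context
  fixes B C :: "nat set" and u v :: nat and m :: "nat set"
  assumes fin: "finite B" "finite C" "finite m" and disj: "B \<inter> C = {}"
    and uv: "u \<in> B" "v \<in> C" "(u, v) \<in> E" and symE: "sym E"
    and bridge: "\<forall>x\<in>B. \<forall>y\<in>C. (x, y) \<in> E \<longrightarrow> x = u \<and> y = v"
begin

lemma none_kept_merge:
  "none_kept (B \<union> C) m \<longleftrightarrow>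
    (\<exists>a b. a \<union> b = m \<and> a \<inter> b = {} \<and> none_kept B a \<and> none_kept C b)"
  unfolding none_kept_def colors_Un[OF fin(1,2) disj] tokens_split[OF fin(3)] ..

lemma colors_diff_merge:
  assumes "S \<subseteq> B" "T \<subseteq> C"
  shows "colors (B \<union> C - (S \<union> T)) = tokens m \<longleftrightarrow>
    (\<exists>a b. a \<union> b = m \<and> a \<inter> b = {} \<and> colors (B - S) = tokens a \<and> colors (C - T) = tokens b)"
proof -
  have "B \<union> C - (S \<union> T) = (B - S) \<union> (C - T)" using assms disj by blast
  then have "colors (B \<union> C - (S \<union> T)) = colors (B - S) + colors (C - T)"
    using colors_Un[of "B - S" "C - T"] fin disj by auto
  then show ?thesis using tokens_split[OF fin(3)] by simp
qed

lemma ex_subset_Un: "(\<exists>T\<subseteq>B \<union> C. P T) \<longleftrightarrow> (\<exists>S\<subseteq>B. \<exists>T\<subseteq>C. P (S \<union> T))"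
proof
  assume "\<exists>T\<subseteq>B \<union> C. P T"
  then obtain T where T: "T \<subseteq> B \<union> C" "P T" by blast
  moreover have "T \<inter> B \<union> T \<inter> C = T" using T by blast
  ultimately show "\<exists>S\<subseteq>B. \<exists>T\<subseteq>C. P (S \<union> T)" 
    by (intro exI[of _ "T \<inter> B"] conjI exI[of _ "T \<inter> C"]) auto
qed blast

lemma cut_connected_merge:
  assumes "S \<subseteq> B" "T \<subseteq> C"
  shows "cut_connected E (S \<union> T) \<longleftrightarrow> cut_connected E S \<and> T = {} \<or> S = {} \<and> cut_connected E T \<or>
    u \<in> S \<and> v \<in> T \<and> cut_connected E S \<and> cut_connected E T"
proof (cases "S = {} \<or> T = {}")
  case True
  then show ?thesis by (auto simp: cut_connected_def[of E "{}"])
next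
  case False
  then show ?thesis
    using cut_connected_bridge[OF symE disj uv(3) bridge[rule_format], of S T] assms by auto
qed

text \<open>The kept part contains \<open>u\<close>, so its trace on \<open>C\<close> is either
  empty or reached through \<open>uv\<close>, and then it is connected and contains
  \<open>v\<close>.\<close>

lemma root_kept_merge:
  "root_kept (B \<union> C) u m \<longleftrightarrow>
    (\<exists>a b. a \<union> b = m \<and> a \<inter> b = {} \<and> root_kept B u a \<and> (root_kept C v b \<or> none_kept C b))"
proof -
  \<comment> \<open>With predicate variables in place of the concrete conditions, exchanging the
    choice of the kept part with that of the splitting is pure first-order reasoning.\<close>
  have distrib: "(\<exists>S\<subseteq>B. \<exists>T\<subseteq>C. p S \<and> (T = {} \<or> q T) \<and> (\<exists>a b. r a b \<and> f S a \<and> g T b)) \<longleftrightarrow>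
      (\<exists>a b. r a b \<and> (\<exists>S\<subseteq>B. p S \<and> f S a) \<and> ((\<exists>T\<subseteq>C. q T \<and> g T b) \<or> g {} b))"
    for p q :: "nat set \<Rightarrow> bool" and r f g :: "nat set \<Rightarrow> nat set \<Rightarrow> bool"
    by blast
  have "u \<in> S \<union> T \<and> cut_connected E (S \<union> T) \<and> colors (B \<union> C - (S \<union> T)) = tokens m \<longleftrightarrow>
      (u \<in> S \<and> cut_connected E S) \<and> (T = {} \<or> v \<in> T \<and> cut_connected E T) \<and>
      (\<exists>a b. (a \<union> b = m \<and> a \<inter> b = {}) \<and> colors (B - S) = tokens a \<and> colors (C - T) = tokens b)"
    if "S \<subseteq> B" "T \<subseteq> C" for S T
  proof -
    have "u \<in> S \<union> T \<and> cut_connected E (S \<union> T) \<longleftrightarrow>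
        (u \<in> S \<and> cut_connected E S) \<and> (T = {} \<or> v \<in> T \<and> cut_connected E T)"
      unfolding cut_connected_merge[OF that] using that uv disj by auto
    then show ?thesis unfolding colors_diff_merge[OF that] by (simp only: conj_assoc[symmetric])
  qed
  then have "root_kept (B \<union> C) u m \<longleftrightarrow> (\<exists>S\<subseteq>B. \<exists>T\<subseteq>C. (u \<in> S \<and> cut_connected E S) \<and>
      (T = {} \<or> v \<in> T \<and> cut_connected E T) \<and>
      (\<exists>a b. (a \<union> b = m \<and> a \<inter> b = {}) \<and> colors (B - S) = tokens a \<and> colors (C - T) = tokens b))"
    unfolding root_kept_def ex_subset_Un by (simp cong: conj_cong)
  from this[unfolded distrib] show ?thesis
    unfolding root_kept_def none_kept_def Diff_empty conj_assoc .
qed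

text \<open>The three disjuncts are a kept part inside \<open>B\<close>, one inside
  \<open>C\<close>, and one across the edge \<open>uv\<close>.\<close>

lemma some_kept_merge:
  "some_kept (B \<union> C) m \<longleftrightarrow>
    (\<exists>a b. a \<union> b = m \<and> a \<inter> b = {} \<and>
      (some_kept B a \<and> none_kept C b \<or> none_kept B a \<and> some_kept C b \<or>
       root_kept B u a \<and> root_kept C v b))"
proof -
  have distrib: "(\<exists>S\<subseteq>B. \<exists>T\<subseteq>C. (p S \<and> T = {} \<or> S = {} \<and> p T \<or> u \<in> S \<and> v \<in> T \<and> p S \<and> p T) \<and>
        (\<exists>a b. r a b \<and> f S a \<and> g T b)) \<longleftrightarrow>
      (\<exists>a b. r a b \<and> ((\<exists>S\<subseteq>B. p S \<and> f S a) \<and> g {} b \<or> f {} a \<and> (\<exists>T\<subseteq>C. p T \<and> g T b) \<or>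
        (\<exists>S\<subseteq>B. u \<in> S \<and> p S \<and> f S a) \<and> (\<exists>T\<subseteq>C. v \<in> T \<and> p T \<and> g T b)))"
    (is "?L \<longleftrightarrow> ?R")
    for p :: "nat set \<Rightarrow> bool" and r f g :: "nat set \<Rightarrow> nat set \<Rightarrow> bool"
  proof
    show "?L \<Longrightarrow> ?R" by blast
    show "?R \<Longrightarrow> ?L" by (elim exE conjE disjE) blast+
  qed
  have "some_kept (B \<union> C) m \<longleftrightarrow> (\<exists>S\<subseteq>B. \<exists>T\<subseteq>C.
      (cut_connected E S \<and> T = {} \<or> S = {} \<and> cut_connected E T \<or>
       u \<in> S \<and> v \<in> T \<and> cut_connected E S \<and> cut_connected E T) \<and>
      (\<exists>a b. (a \<union> b = m \<and> a \<inter> b = {}) \<and> colors (B - S) = tokens a \<and> colors (C - T) = tokens b))"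
    unfolding some_kept_def ex_subset_Un
    using cut_connected_merge colors_diff_merge by (simp cong: conj_cong)
  also have "\<dots> \<longleftrightarrow> (\<exists>a b. (a \<union> b = m \<and> a \<inter> b = {}) \<and>
      ((\<exists>S\<subseteq>B. cut_connected E S \<and> colors (B - S) = tokens a) \<and> colors (C - {}) = tokens b \<or>
       colors (B - {}) = tokens a \<and> (\<exists>T\<subseteq>C. cut_connected E T \<and> colors (C - T) = tokens b) \<or>
       (\<exists>S\<subseteq>B. u \<in> S \<and> cut_connected E S \<and> colors (B - S) = tokens a) \<and>
       (\<exists>T\<subseteq>C. v \<in> T \<and> cut_connected E T \<and> colors (C - T) = tokens b)))"
    by (rule distrib)
  finally show ?thesis
    unfolding root_kept_def none_kept_def some_kept_def Diff_empty conj_assoc .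
qed

end

end

section \<open>Codes of pairs of disjoint token sets\<close>

text \<open>
  A token set \<open>m\<close> is coded by \<open>W * set_encode m\<close>. With \<open>W = 2 * n\<close> exceeding every row number \<open>j\<close>,
  the table entry for \<open>m\<close> in row \<open>j\<close> has the address \<open>j + W * set_encode m\<close>, and codes of disjoint sets
  can be added.
\<close>

definition pair_codes :: "nat \<Rightarrow> nat \<Rightarrow> (nat \<times> nat) set" where
  "pair_codes W i = {(W * set_encode a, W * set_encode b) | a b.
     a \<subseteq> {..<i} \<and> b \<subseteq> {..<i} \<and> a \<inter> b = {}}"

lemma pair_codesI:
  "a \<subseteq> {..<i} \<Longrightarrow> b \<subseteq> {..<i} \<Longrightarrow> a \<inter> b = {} \<Longrightarrow>
    (W * set_encode a, W * set_encode b) \<in> pair_codes W i"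
  unfolding pair_codes_def by blast

lemma set_encode_le: "m \<subseteq> {..<i} \<Longrightarrow> set_encode m \<le> 2 ^ i - 1"
proof -
  assume "m \<subseteq> {..<i}"
  then have "set_encode m \<le> (\<Sum>j<i. 2 ^ j)"
    unfolding set_encode_def by (intro sum_mono2) auto
  then show ?thesis by (simp add: lessThan_def flip: mask_eq_sum_exp_nat)
qed

lemma set_encode_less: "m \<subseteq> {..<i} \<Longrightarrow> set_encode m < 2 ^ i"
  using set_encode_le[of m i] zero_less_power[of "2::nat" i] by linarith

lemma set_encode_lessThan: "set_encode {..<i} = 2 ^ i - 1"
  by (simp add: set_encode_def lessThan_def flip: mask_eq_sum_exp_nat)

lemma set_encode_Un:
  "finite a \<Longrightarrow> finite b \<Longrightarrow> a \<inter> b = {} \<Longrightarrow> set_encode (a \<union> b) = set_encode a + set_encode b"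
  unfolding set_encode_def by (rule sum.union_disjoint)

lemma set_encode_eq_iff: "finite a \<Longrightarrow> finite b \<Longrightarrow> set_encode a = set_encode b \<longleftrightarrow> a = b"
  using set_encode_eq by auto

lemma pair_codes_0: "pair_codes W 0 = {(0, 0)}"
  by (auto simp: pair_codes_def)

text \<open>Token \<open>i\<close> goes to neither set, to the left one or to the right one. This
  recurrence is what \<open>double_pairs\<close> implements.\<close>

lemma pair_codes_Suc:
  "pair_codes W (Suc i) = pair_codes W i \<union>
     (\<lambda>(x, y). (x + W * 2 ^ i, y)) ` pair_codes W i \<union> (\<lambda>(x, y). (x, y + W * 2 ^ i)) ` pair_codes W i"
  (is "_ = ?S \<union> ?L \<union> ?R")
proof
  have ins: "set_encode (insert i a) = set_encode a + 2 ^ i" if "a \<subseteq> {..<i}" for a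
    using that finite_subset[OF that] by (subst set_encode_insert) auto
  show "pair_codes W (Suc i) \<subseteq> ?S \<union> ?L \<union> ?R"
  proof
    fix x assume "x \<in> pair_codes W (Suc i)"
    then obtain a b where ab: "x = (W * set_encode a, W * set_encode b)"
      "a \<subseteq> {..<Suc i}" "b \<subseteq> {..<Suc i}" "a \<inter> b = {}"
      by (auto simp: pair_codes_def)
    have sub: "a - {i} \<subseteq> {..<i}" "b - {i} \<subseteq> {..<i}" using ab by (auto simp: lessThan_Suc)
    consider "i \<notin> a" "i \<notin> b" | "i \<in> a" "i \<notin> b" | "i \<notin> a" "i \<in> b" using ab by blast
    then show "x \<in> ?S \<union> ?L \<union> ?R"
    proof cases
      case 1
      then have "x \<in> ?S" using ab sub by (auto intro: pair_codesI)
      then show ?thesis by blast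
    next
      case 2
      then have "(W * set_encode (a - {i}), W * set_encode b) \<in> ?S"
        using ab sub by (intro pair_codesI) auto
      moreover have "W * set_encode a = W * set_encode (a - {i}) + W * 2 ^ i"
        using ins[OF sub(1)] 2 by (simp add: insert_absorb algebra_simps)
      ultimately have "x \<in> ?L" using ab by (intro image_eqI) auto
      then show ?thesis by blast
    next
      case 3
      then have "(W * set_encode a, W * set_encode (b - {i})) \<in> ?S"
        using ab sub by (intro pair_codesI) auto
      moreover have "W * set_encode b = W * set_encode (b - {i}) + W * 2 ^ i"
        using ins[OF sub(2)] 3 by (simp add: insert_absorb algebra_simps)
      ultimately have "x \<in> ?R" using ab by (intro image_eqI) auto
      then show ?thesis by blast
    qed
  qed
  show "?S \<union> ?L \<union> ?R \<subseteq> pair_codes W (Suc i)"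
  proof
    fix x assume x: "x \<in> ?S \<union> ?L \<union> ?R"
    then obtain a b where ab: "a \<subseteq> {..<i}" "b \<subseteq> {..<i}" "a \<inter> b = {}"
      and xs: "x = (W * set_encode a, W * set_encode b) \<or>
        x = (W * set_encode a + W * 2 ^ i, W * set_encode b) \<or>
        x = (W * set_encode a, W * set_encode b + W * 2 ^ i)"
      by (auto simp: pair_codes_def)
    have "i \<notin> a" "i \<notin> b" using ab by auto
    moreover have "a \<subseteq> {..<Suc i}" "b \<subseteq> {..<Suc i}" "insert i a \<subseteq> {..<Suc i}" "insert i b \<subseteq> {..<Suc i}"
      using ab by (auto simp: lessThan_Suc)
    ultimately have
      "(W * set_encode a, W * set_encode b) \<in> pair_codes W (Suc i)"
      "(W * set_encode (insert i a), W * set_encode b) \<in> pair_codes W (Suc i)"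
      "(W * set_encode a, W * set_encode (insert i b)) \<in> pair_codes W (Suc i)"
      using ab(3) by (intro pair_codesI; blast)+
    then show "x \<in> pair_codes W (Suc i)"
      using xs ab by (auto simp: ins algebra_simps)
  qed
qed

text \<open>The codes of disjoint sets add up to the code of their union, which is at most
  \<open>W * (2 ^ i - 1)\<close>. The slack \<open>W\<close> leaves room for a row number in every
  address.\<close>

lemma pair_codes_bound:
  assumes "(x, y) \<in> pair_codes W i" shows "x + y + W \<le> W * 2 ^ i"
proof -
  from assms obtain a b where ab: "x = W * set_encode a" "y = W * set_encode b"
      "a \<subseteq> {..<i}" "b \<subseteq> {..<i}" "a \<inter> b = {}"
    by (auto simp: pair_codes_def)
  have "set_encode a + set_encode b = set_encode (a \<union> b)"
    using ab finite_subset[OF ab(3)] finite_subset[OF ab(4)] set_encode_Un by simp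
  then have "set_encode a + set_encode b + 1 \<le> 2 ^ i"
    using set_encode_less[of "a \<union> b" i] ab by simp
  then have "W * (set_encode a + set_encode b + 1) \<le> W * 2 ^ i" by (rule mult_le_mono2)
  then show ?thesis using ab by (simp add: algebra_simps)
qed

section \<open>The program\<close>

abbreviation (input) Semi :: "com \<Rightarrow> com \<Rightarrow> com" (infixr \<open>;;\<close> 60) where "P ;; Q \<equiv> Seq P Q"

abbreviation (input) r_n :: nat where "r_n \<equiv> 0"
abbreviation (input) r_edges :: nat where "r_edges \<equiv> 1"
abbreviation (input) r_motif :: nat where "r_motif \<equiv> 2"
abbreviation (input) r_i :: nat where "r_i \<equiv> 6"
abbreviation (input) r_v :: nat where "r_v \<equiv> 7"
abbreviation (input) r_next :: nat where "r_next \<equiv> 8"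
abbreviation (input) r_l :: nat where "r_l \<equiv> 9"
abbreviation (input) r_pairs :: nat where "r_pairs \<equiv> 10"
abbreviation (input) r_weight :: nat where "r_weight \<equiv> 11"
abbreviation (input) r_stride :: nat where "r_stride \<equiv> 12"
abbreviation (input) r_u :: nat where "r_u \<equiv> 13"
abbreviation (input) r_p :: nat where "r_p \<equiv> 14"
abbreviation (input) r_x :: nat where "r_x \<equiv> 15"
abbreviation (input) r_y :: nat where "r_y \<equiv> 16"
abbreviation (input) r_d :: nat where "r_d \<equiv> 17"
abbreviation (input) r_rowu :: nat where "r_rowu \<equiv> 18"
abbreviation (input) r_rowv :: nat where "r_rowv \<equiv> 19"

abbreviation (input) a_src :: nat where "a_src \<equiv> 0"
abbreviation (input) a_dst :: nat where "a_dst \<equiv> 1"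
abbreviation (input) a_color :: nat where "a_color \<equiv> 2"
abbreviation (input) a_motif :: nat where "a_motif \<equiv> 3"
abbreviation (input) a_count :: nat where "a_count \<equiv> 4"
abbreviation (input) a_token :: nat where "a_token \<equiv> 5"
abbreviation (input) a_left :: nat where "a_left \<equiv> 6"
abbreviation (input) a_right :: nat where "a_right \<equiv> 7"
abbreviation (input) a_weight :: nat where "a_weight \<equiv> 8"
abbreviation (input) a_root :: nat where "a_root \<equiv> 9"
abbreviation (input) a_none :: nat where "a_none \<equiv> 10"
abbreviation (input) a_some :: nat where "a_some \<equiv> 11"
abbreviation (input) a_row :: nat where "a_row \<equiv> 12"
abbreviation (input) a_deg :: nat where "a_deg \<equiv> 13"
abbreviation (input) a_nbs :: nat where "a_nbs \<equiv> 14"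

definition count_step :: com where
  "count_step = Load r_x a_motif r_i ;; Load r_y a_count r_x ;; Add r_y r_y one ;; Store a_count r_x r_y"

definition count_motif :: com where
  "count_motif = For r_i r_motif count_step"

text \<open>The vertices consume the motif counts in order; a vertex that finds the count of its
  color exhausted contributes a token.\<close>

definition token_step :: com where
  "token_step = Load r_x a_color r_i ;; Load r_y a_count r_x ;;
     If (Eq r_y zero) (Store a_token r_l r_x ;; Add r_l r_l one)
       (Sub r_y r_y one ;; Store a_count r_x r_y)"

definition collect_tokens :: com where
  "collect_tokens = For r_i r_n token_step"

definition pair_step :: com where
  "pair_step = Load r_x a_left r_p ;; Load r_y a_right r_p ;;
     Add r_d r_x r_weight ;; Store a_left r_pairs r_d ;; Store a_right r_pairs r_y ;;
     Add r_pairs r_pairs one ;;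
     Add r_d r_y r_weight ;; Store a_left r_pairs r_x ;; Store a_right r_pairs r_d ;;
     Add r_pairs r_pairs one"

text \<open>The loop bound is copied to \<open>r_u\<close> because \<open>r_pairs\<close> grows
  while the old pairs are scanned. The weight of each token is kept for
  \<open>init_token\<close>.\<close>

definition double_pairs :: com where
  "double_pairs = Store a_weight r_i r_weight ;; Copy r_u r_pairs ;; For r_p r_u pair_step ;;
     Add r_weight r_weight r_weight"

text \<open>The initial one-element list \<open>(0, 0)\<close> is already present in the zeroed
  arrays.\<close>

definition build_pairs :: com where
  "build_pairs = Copy r_pairs one ;; Add r_stride r_n r_n ;; Copy r_weight r_stride ;;
     For r_i r_l double_pairs"

text \<open>The address written is the entry of the singleton of token \<open>r_p\<close> in row
  \<open>r_i\<close>. Here \<open>r_v\<close> temporarily holds the color of vertex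
  \<open>r_i\<close>.\<close>

definition init_token :: com where
  "init_token = Load r_x a_token r_p ;;
     If (Eq r_x r_v) (Load r_d a_weight r_p ;; Add r_d r_d r_i ;; Store a_none r_d one) Skip"

definition init_row :: com where
  "init_row = Store a_root r_i one ;; Store a_some r_i one ;; Store a_row r_i r_i ;;
     Load r_v a_color r_i ;; For r_p r_l init_token"

definition init_rows :: com where
  "init_rows = For r_i r_n init_row"

text \<open>The remainder modulo \<open>n\<close> of a number below \<open>2 * n\<close>, without
  division.\<close>

definition reduce :: com where
  "reduce = If (Le r_n r_x) (Sub r_x r_x r_n) Skip"

definition link :: "nat \<Rightarrow> nat \<Rightarrow> com" where
  "link a b = Load r_x a_deg a ;; Add r_x r_x one ;; Store a_deg a r_x ;;
     Load r_x a_nbs a ;; Add r_x r_x b ;; reduce ;; Store a_nbs a r_x"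

definition read_edge :: com where
  "read_edge = Load r_u a_src r_i ;; Load r_v a_dst r_i ;; link r_u r_v ;; link r_v r_u"

definition read_edges :: com where
  "read_edges = For r_i r_edges read_edge"

definition store_and :: "nat \<Rightarrow> nat \<Rightarrow> nat \<Rightarrow> com" where
  "store_and a x y = If (Eq x one) (If (Eq y one) (Store a r_d one) Skip) Skip"

text \<open>
  Each merge writes to the fresh row \<open>r_next\<close>, which still holds zeros, so that no row is read and
  written in the same merge and none has to be cleared.
\<close>

definition merge_stores :: com where
  "merge_stores = store_and a_root 20 23 ;; store_and a_root 20 24 ;; store_and a_none 21 24 ;;
     store_and a_some 22 24 ;; store_and a_some 21 25 ;; store_and a_some 20 23"

text \<open>Registers 20 to 22 receive the root, none and some bits of the left set in the row of
  \<open>u\<close>, registers 23 to 25 those of the right set in the row of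
  \<open>v\<close>.\<close>

definition merge_step :: com where
  "merge_step = Load r_x a_left r_p ;; Load r_y a_right r_p ;; Add r_d r_x r_y ;; Add r_d r_d r_next ;;
     Add r_x r_x r_rowu ;; Add r_y r_y r_rowv ;;
     Load 20 a_root r_x ;; Load 21 a_none r_x ;; Load 22 a_some r_x ;;
     Load 23 a_root r_y ;; Load 24 a_none r_y ;; Load 25 a_some r_y ;;
     merge_stores"

text \<open>The degree of \<open>v\<close> becomes 0 so that the scan does not take it for a leaf
  later. As subtraction is truncated, \<open>r_n\<close> is added before \<open>r_v\<close> is
  subtracted.\<close>

definition remove_leaf :: com where
  "remove_leaf = Store a_row r_u r_next ;; Add r_next r_next one ;; Store a_deg r_v zero ;;
     Load r_x a_deg r_u ;; Sub r_x r_x one ;; Store a_deg r_u r_x ;;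
     Load r_x a_nbs r_u ;; Add r_x r_x r_n ;; Sub r_x r_x r_v ;; reduce ;; Store a_nbs r_u r_x ;;
     Copy r_v r_u"

definition eliminate :: com where
  "eliminate = Load r_u a_nbs r_v ;; Load r_rowu a_row r_u ;; Load r_rowv a_row r_v ;;
     For r_p r_pairs merge_step ;; remove_leaf"

text \<open>\<open>r_i\<close> scans the vertices once. \<open>r_v\<close> departs from it only to
  follow a chain of merges, after which the scan resumes behind \<open>r_i\<close>.\<close>

definition strip_step :: com where
  "strip_step = Load r_x a_deg r_v ;;
     If (Eq r_x one) eliminate (Add r_i r_i one ;; Copy r_v r_i)"

definition strip_leaves :: com where
  "strip_leaves = Const r_i 0 ;; Const r_v 0 ;; Copy r_next r_n ;; While (Lt r_i r_n) strip_step"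

text \<open>The last row in use belongs to the surviving vertex, and
  \<open>r_weight - r_stride\<close> is \<open>2 * n * (2 ^ L - 1)\<close>, the code of the full
  token set.\<close>

definition answer :: com where
  "answer = Sub r_next r_next one ;; Sub r_weight r_weight r_stride ;;
     Add r_next r_next r_weight ;; Load 0 a_some r_next"

text \<open>The first test precedes the reading of the motif and bounds the time for it by
  \<open>n\<close>. The second decides by counting alone whether the motif is contained in the
  vertex colors: otherwise there are too many tokens.\<close>

definition graph_motif_program :: com where
  "graph_motif_program = Const one 1 ;;
     If (Lt r_n r_motif) (Const 0 0)
       (count_motif ;; collect_tokens ;; Add r_x r_l r_motif ;;
        If (Eq r_x r_n)
          (build_pairs ;; init_rows ;; read_edges ;; strip_leaves ;; answer)
          (Const 0 0))"

lemma wp_SeqI: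
  "wp w P Q' s \<Longrightarrow> (\<And>t s'. Q' t s' \<Longrightarrow> wp w R (\<lambda>u. Q (t + u)) s') \<Longrightarrow> wp w (Seq P R) Q s"
  unfolding wp_Seq by (rule wp_mono)

section \<open>Collecting the surplus colors\<close>

lemma wp_count_motif:
  assumes "reg s one = 1" "reg s r_motif = length ms" "length ms < 2 ^ w"
    and "\<And>j. j < length ms \<Longrightarrow> arr s a_motif j = ms ! j" "arr s a_count = (\<lambda>_. 0)"
  shows "wp w count_motif (\<lambda>t s'. arr s' a_count = count (mset ms) \<and>
     frame {r_i, r_x, r_y} {a_count} s s' \<and> t \<le> 6 * length ms + 2) s"
  unfolding count_motif_def
proof (rule wp_For[where N = "length ms" and T = "\<lambda>_. 4"
      and J = "\<lambda>k s'. arr s' a_count = count (mset (take k ms))"])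
  fix k s'
  assume k: "k < length ms" and J: "arr s' a_count = count (mset (take k ms))" and ki: "reg s' r_i = k"
    and fr: "frame (insert r_i (regs_written count_step)) (arrs_written count_step) s s'"
  have "arr s' a_motif k = ms ! k" "reg s' one = 1"
    using fr assms k by (auto simp: frame_def count_step_def)
  moreover have "count (mset (take k ms)) (ms ! k) + 1 < 2 ^ w"
  proof -
    have "count (mset (take k ms)) (ms ! k) \<le> length (take k ms)" by (metis count_le_length count_mset)
    then show ?thesis using k assms(3) by simp
  qed
  ultimately show "wp w count_step
    (\<lambda>t s''. t \<le> 4 \<and> arr (set_reg r_i (Suc k) s'') a_count = count (mset (take (Suc k) ms))) s'"
    using J ki k by (auto simp: take_Suc_conv_app_nth count_step_def)
qed (use assms in \<open>auto simp: count_step_def frame_def\<close>)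

lemma wp_collect_tokens:
  fixes \<chi> :: "nat \<Rightarrow> nat"
  assumes "reg s one = 1" "reg s zero = 0" "reg s r_n = n" "n < 2 ^ w"
    and "\<And>v. v < n \<Longrightarrow> arr s a_color v = \<chi> v" "arr s a_count = count M" "reg s r_l = 0"
  shows "wp w collect_tokens (\<lambda>t s'.
     image_mset (arr s' a_token) (mset_set {..<reg s' r_l}) = image_mset \<chi> (mset_set {..<n}) - M \<and>
     reg s' r_l \<le> n \<and>
     frame {r_i, r_x, r_y, r_l} {a_count, a_token} s s' \<and> t \<le> 7 * n + 2) s"
  unfolding collect_tokens_def
proof (rule wp_For[where N = n and T = "\<lambda>_. 5"
      and J = "\<lambda>k s'. arr s' a_count = count (M - image_mset \<chi> (mset_set {..<k})) \<and>
        reg s' r_l \<le> k \<and>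
        image_mset (arr s' a_token) (mset_set {..<reg s' r_l}) = image_mset \<chi> (mset_set {..<k}) - M"])
  fix k s'
  let ?V = "image_mset \<chi> (mset_set {..<k})"
  let ?J = "\<lambda>k s'. arr s' a_count = count (M - image_mset \<chi> (mset_set {..<k})) \<and> reg s' r_l \<le> k \<and>
        image_mset (arr s' a_token) (mset_set {..<reg s' r_l}) = image_mset \<chi> (mset_set {..<k}) - M"
  assume k: "k < n" and J: "?J k s'"
    and ki: "reg s' r_i = k" and fr: "frame (insert r_i (regs_written token_step)) (arrs_written token_step) s s'"
  have s': "arr s' a_color k = \<chi> k" "reg s' one = 1" "reg s' zero = 0"
    using fr assms k by (auto simp: frame_def token_step_def)
  have V: "image_mset \<chi> (mset_set {..<Suc k}) = add_mset (\<chi> k) ?V"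
    by (simp add: lessThan_Suc)
  have tok: "image_mset ((arr s' a_token)(reg s' r_l := x)) (mset_set {..<Suc (reg s' r_l)}) =
      add_mset x (image_mset (arr s' a_token) (mset_set {..<reg s' r_l}))" for x
    by (simp add: lessThan_Suc) (intro image_mset_cong, auto)
  \<comment> \<open>Vertex \<open>k\<close> is surplus exactly if the earlier vertices of its color
    exhaust the motif.\<close>
  have "M - add_mset (\<chi> k) ?V = M - ?V \<and> add_mset (\<chi> k) ?V - M = add_mset (\<chi> k) (?V - M)"
    if "count M (\<chi> k) \<le> count ?V (\<chi> k)"
    using that by (auto simp: multiset_eq_iff)
  moreover have "count (M - add_mset (\<chi> k) ?V) = (count (M - ?V))(\<chi> k := count (M - ?V) (\<chi> k) - 1) \<and>
      add_mset (\<chi> k) ?V - M = ?V - M"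
    if "\<not> count M (\<chi> k) \<le> count ?V (\<chi> k)"
    using that by (auto simp: multiset_eq_iff)
  ultimately show "wp w token_step (\<lambda>t s''. t \<le> 5 \<and> ?J (Suc k) (set_reg r_i (Suc k) s'')) s'"
    using J ki s' tok k assms(4) unfolding V by (auto simp: token_step_def)
qed (use assms in \<open>auto simp: token_step_def frame_def\<close>)

section \<open>Building the tables\<close>

text \<open>The pairs only feed disjunctions, so neither their order nor repetitions matter.\<close>

definition pair_set :: "state \<Rightarrow> nat \<Rightarrow> (nat \<times> nat) set" where
  "pair_set s K = (\<lambda>p. (arr s a_left p, arr s a_right p)) ` {..<K}"

lemma pair_set_simps [simp]:
  "pair_set s (Suc K) = insert (arr s a_left K, arr s a_right K) (pair_set s K)"
  "pair_set (set_reg x v s) K = pair_set s K"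
  "K \<le> i \<Longrightarrow> pair_set (set_arr a i v s) K = pair_set s K"
  by (auto simp: pair_set_def lessThan_Suc intro!: image_cong)

lemma wp_double_pairs:
  assumes "reg s one = 1" "reg s r_pairs = N" "reg s r_weight = W" "2 * W < 2 ^ w"
    and bnd: "3 * N < 2 ^ w" "\<And>x y. (x, y) \<in> pair_set s N \<Longrightarrow> x + W < 2 ^ w \<and> y + W < 2 ^ w"
  shows "wp w double_pairs (\<lambda>t s'. reg s' r_pairs = 3 * N \<and>
     pair_set s' (3 * N) = pair_set s N \<union> (\<lambda>(x, y). (x + W, y)) ` pair_set s N \<union>
       (\<lambda>(x, y). (x, y + W)) ` pair_set s N \<and>
     reg s' r_weight = 2 * W \<and> arr s' a_weight = (arr s a_weight)(reg s r_i := W) \<and>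
     t \<le> 12 * N + 5) s"
  unfolding double_pairs_def wp_Seq[of _ "Store _ _ _"] wp_Seq[of _ "Copy _ _"] wp_simps
proof (rule wp_SeqI)
  let ?s = "set_reg r_u (reg (set_arr a_weight (reg s r_i) (reg s r_weight) s) r_pairs)
    (set_arr a_weight (reg s r_i) (reg s r_weight) s)"
  \<comment> \<open>The first \<open>N\<close> entries stay intact while they are scanned; the two
    shifted copies of each are appended behind them.\<close>
  let ?J = "\<lambda>k s'. reg s' r_pairs = N + 2 * k \<and>
        (\<forall>p<N. arr s' a_left p = arr s a_left p \<and> arr s' a_right p = arr s a_right p) \<and>
        pair_set s' (N + 2 * k) = pair_set s N \<union> (\<lambda>(x, y). (x + W, y)) ` pair_set s k \<union>
          (\<lambda>(x, y). (x, y + W)) ` pair_set s k"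
  let ?fr = "frame (insert r_p (regs_written pair_step)) (arrs_written pair_step) ?s"
  show "wp w (For r_p r_u pair_step) (\<lambda>t s'. ?J N s' \<and> ?fr s' \<and> t \<le> 12 * N + 2) ?s"
  proof (rule wp_For[where N = N and T = "\<lambda>_. 10" and J = ?J])
    fix k s'
    assume k: "k < N" and J: "?J k s'" and ki: "reg s' r_p = k" and fr: "?fr s'"
    have s': "reg s' one = 1" "reg s' r_weight = W"
      using fr assms by (auto simp: frame_def pair_step_def)
    let ?K = "N + 2 * k" and ?L = "arr s' a_left" and ?R = "arr s' a_right"
    have old: "?L k = arr s a_left k" "?R k = arr s a_right k" using J k by auto
    then have new: "insert (?L k + W, ?R k) (insert (?L k, ?R k + W) (pair_set s' ?K)) =
        pair_set s N \<union> (\<lambda>(x, y). (x + W, y)) ` pair_set s (Suc k) \<union>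
            (\<lambda>(x, y). (x, y + W)) ` pair_set s (Suc k)"
      using J unfolding pair_set_def lessThan_Suc by auto
    have "?L k + W < 2 ^ w \<and> ?R k + W < 2 ^ w"
      using bnd(2)[of "?L k" "?R k"] k unfolding old pair_set_def by blast
    then show "wp w pair_step (\<lambda>t s''. t \<le> 10 \<and> ?J (Suc k) (set_reg r_p (Suc k) s'')) s'"
      using J ki s' bnd(1) k new by (auto simp: pair_step_def insert_commute)
  qed (use assms in \<open>auto simp: pair_set_def pair_step_def\<close>)
next
  fix t s'
  let ?s = "set_reg r_u (reg (set_arr a_weight (reg s r_i) (reg s r_weight) s) r_pairs)
    (set_arr a_weight (reg s r_i) (reg s r_weight) s)"
  assume "(reg s' r_pairs = N + 2 * N \<and>
        (\<forall>p<N. arr s' a_left p = arr s a_left p \<and> arr s' a_right p = arr s a_right p) \<and>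
        pair_set s' (N + 2 * N) = pair_set s N \<union> (\<lambda>(x, y). (x + W, y)) ` pair_set s N \<union>
          (\<lambda>(x, y). (x, y + W)) ` pair_set s N) \<and>
        frame (insert r_p (regs_written pair_step)) (arrs_written pair_step) ?s s' \<and> t \<le> 12 * N + 2"
  then show "wp w (Add r_weight r_weight r_weight) (\<lambda>u s'.
     reg s' r_pairs = 3 * N \<and>
     pair_set s' (3 * N) = pair_set s N \<union> (\<lambda>(x, y). (x + W, y)) ` pair_set s N \<union>
       (\<lambda>(x, y). (x, y + W)) ` pair_set s N \<and>
     reg s' r_weight = 2 * W \<and> arr s' a_weight = (arr s a_weight)(reg s r_i := W) \<and>
     1 + (1 + (t + u)) \<le> 12 * N + 5) s'"
    using assms by (auto simp: pair_set_def frame_def pair_step_def)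
qed

lemma sum_pow3: "2 * (\<Sum>k<L. 3 ^ k) + 1 = (3 :: nat) ^ L"
  by (induction L) auto

lemma wp_build_pairs:
  assumes "reg s one = 1" "reg s r_n = n" "reg s r_l = L" and n: "0 < n"
    and bnd: "4 * (3 ^ L * n) < 2 ^ w" and z: "arr s a_left 0 = 0" "arr s a_right 0 = 0"
  shows "wp w build_pairs (\<lambda>t s'. reg s' r_pairs = 3 ^ L \<and>
     pair_set s' (3 ^ L) = pair_codes (2 * n) L \<and>
     reg s' r_stride = 2 * n \<and> reg s' r_weight = 2 * n * 2 ^ L \<and>
     (\<forall>i<L. arr s' a_weight i = 2 * n * 2 ^ i) \<and>
     frame {r_i, r_p, r_u, r_x, r_y, r_d, r_pairs, r_weight, r_stride} {a_left, a_right, a_weight} s s' \<and>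
     t \<le> 20 * 3 ^ L) s"
proof -
  have pow: "2 ^ k * n \<le> 3 ^ k * n" for k by (simp add: power_mono)
  have le_L: "k \<le> L \<Longrightarrow> 3 ^ k * n \<le> 3 ^ L * n" for k by (simp add: power_increasing)
  have small: "4 * (3 ^ k * n) < 2 ^ w" if "k \<le> L" for k using le_L[OF that] bnd by linarith
  have "3 ^ L \<le> 3 ^ L * n" using n by simp
  then have "L < 2 ^ w" using bnd less_exp[of L] power_mono[of 2 "3::nat" L] by linarith
  have n': "2 * n < 2 ^ w" using small[of 0] by simp
  let ?s = "set_reg r_weight (2 * n) (set_reg r_stride (2 * n) (set_reg r_pairs 1 s))"
  let ?J = "\<lambda>k s'. reg s' r_pairs = 3 ^ k \<and> pair_set s' (3 ^ k) = pair_codes (2 * n) k \<and>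
     reg s' r_weight = 2 * n * 2 ^ k \<and> (\<forall>i<k. arr s' a_weight i = 2 * n * 2 ^ i)"
  have "wp w (For r_i r_l double_pairs) (\<lambda>t s'. ?J L s' \<and>
     frame (insert r_i (regs_written double_pairs)) (arrs_written double_pairs) ?s s' \<and>
     t + 5 \<le> 20 * 3 ^ L) ?s"
  proof (rule wp_For[where N = L and T = "\<lambda>k. 17 * 3 ^ k" and J = ?J])
    fix k s'
    assume k: "k < L" and J: "?J k s'" and ki: "reg s' r_i = k"
      and fr: "frame (insert r_i (regs_written double_pairs)) (arrs_written double_pairs) ?s s'"
    have "3 ^ Suc k * n \<le> 3 ^ L * n" using k by (intro le_L) simp
    moreover have "3 ^ Suc k \<le> 3 ^ Suc k * n" using n by simp
    ultimately have b1: "3 * 3 ^ k < (2 :: nat) ^ w" using bnd unfolding power_Suc by linarith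
    have "2 * (2 * n * 2 ^ k) = 4 * (2 ^ k * n)" by simp
    then have b2: "2 * (2 * n * 2 ^ k) < 2 ^ w" using small[of k] pow[of k] k by linarith
    have b3: "x + 2 * n * 2 ^ k < 2 ^ w \<and> y + 2 * n * 2 ^ k < 2 ^ w" if "(x, y) \<in> pair_codes (2 * n) k" for x y
      using pair_codes_bound[OF that] b2 by linarith
    have one: "reg s' one = 1"
      using fr assms by (auto simp: frame_def double_pairs_def pair_step_def)
    show "wp w double_pairs (\<lambda>t s''. t \<le> 17 * 3 ^ k \<and> ?J (Suc k) (set_reg r_i (Suc k) s'')) s'"
    proof (rule wp_mono[OF wp_double_pairs[OF one, of "3 ^ k" "2 * n * 2 ^ k"]])
      fix t :: nat and s''
      assume a: "reg s'' r_pairs = 3 * 3 ^ k \<and>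
        pair_set s'' (3 * 3 ^ k) = pair_set s' (3 ^ k) \<union>
          (\<lambda>(x, y). (x + 2 * n * 2 ^ k, y)) ` pair_set s' (3 ^ k) \<union>
          (\<lambda>(x, y). (x, y + 2 * n * 2 ^ k)) ` pair_set s' (3 ^ k) \<and>
        reg s'' r_weight = 2 * (2 * n * 2 ^ k) \<and>
        arr s'' a_weight = (arr s' a_weight)(reg s' r_i := 2 * n * 2 ^ k) \<and> t \<le> 12 * 3 ^ k + 5"
      have "12 * 3 ^ k + 5 \<le> 17 * (3 :: nat) ^ k" using one_le_power[of "3 :: nat" k] by linarith
      with a have le: "t \<le> 17 * 3 ^ k" by linarith
      then show "t \<le> 17 * 3 ^ k \<and> ?J (Suc k) (set_reg r_i (Suc k) s'')"
        using a J ki by (auto simp: pair_codes_Suc less_Suc_eq)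
    qed (use b1 b2 b3 J in auto)
  next
    fix t :: nat and s'
    assume t: "?J L s'" "t \<le> (\<Sum>k<L. 17 * 3 ^ k + 2) + 2"
      "frame (insert r_i (regs_written double_pairs)) (arrs_written double_pairs) ?s s'"
    \<comment> \<open>The loop overhead \<open>2\<close> is charged to \<open>2 * 3 ^ k\<close>,
      which leaves a geometric sum.\<close>
    have "(\<Sum>k<L. 17 * 3 ^ k + 2) \<le> (\<Sum>k<L. 19 * (3 :: nat) ^ k)"
      by (intro sum_mono) simp
    moreover have "\<dots> = 19 * (\<Sum>k<L. (3 :: nat) ^ k)" by (simp add: sum_distrib_left)
    ultimately have "t + 5 \<le> 20 * 3 ^ L"
      using t(2) sum_pow3[of L] one_le_power[of "3 :: nat" L] by linarith
    then show "?J L s' \<and>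
      frame (insert r_i (regs_written double_pairs)) (arrs_written double_pairs) ?s s' \<and> t + 5 \<le> 20 * 3 ^ L"
      using t by auto
  qed (use assms \<open>L < 2 ^ w\<close> in \<open>auto simp: double_pairs_def pair_step_def pair_codes_0 pair_set_def\<close>)
  then have "wp w (For r_i r_l double_pairs) (\<lambda>t s'. reg s' r_pairs = 3 ^ L \<and>
     pair_set s' (3 ^ L) = pair_codes (2 * n) L \<and>
     reg s' r_stride = 2 * n \<and> reg s' r_weight = 2 * n * 2 ^ L \<and>
     (\<forall>i<L. arr s' a_weight i = 2 * n * 2 ^ i) \<and>
     frame {r_i, r_p, r_u, r_x, r_y, r_d, r_pairs, r_weight, r_stride} {a_left, a_right, a_weight} s s' \<and>
     1 + (1 + (1 + t)) \<le> 20 * 3 ^ L) ?s"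
    by (rule wp_mono) (auto simp: frame_def double_pairs_def pair_step_def)
  then show ?thesis
    using assms n' unfolding build_pairs_def by (simp add: mult_2)
qed

lemma wp_init_tokens:
  assumes "reg s one = 1" "reg s r_l = L" "L < 2 ^ w"
    and "\<And>i. i < L \<Longrightarrow> arr s a_weight i + reg s r_i < 2 ^ w"
  shows "wp w (For r_p r_l init_token) (\<lambda>t s'. arr s' a_none = (\<lambda>x.
       if \<exists>i<L. x = arr s a_weight i + reg s r_i \<and> arr s a_token i = reg s r_v then 1 else arr s a_none x) \<and>
     frame {r_p, r_x, r_d} {a_none} s s' \<and> t \<le> 7 * L + 2) s"
proof (rule wp_For[where N = L and T = "\<lambda>_. 5" and J = "\<lambda>k s'. arr s' a_none = (\<lambda>x.
     if \<exists>i<k. x = arr s a_weight i + reg s r_i \<and> arr s a_token i = reg s r_v then 1 else arr s a_none x)"])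
  let ?J = "\<lambda>k s'. arr s' a_none = (\<lambda>x.
     if \<exists>i<k. x = arr s a_weight i + reg s r_i \<and> arr s a_token i = reg s r_v then 1 else arr s a_none x)"
  fix k s'
  assume k: "k < L" and J: "?J k s'" and ki: "reg s' r_p = k"
    and fr: "frame (insert r_p (regs_written init_token)) (arrs_written init_token) s s'"
  have s': "reg s' one = 1" "reg s' r_i = reg s r_i" "reg s' r_v = reg s r_v"
      "arr s' a_weight = arr s a_weight" "arr s' a_token = arr s a_token"
    using fr assms by (auto simp: frame_def init_token_def)
  show "wp w init_token (\<lambda>t s''. t \<le> 5 \<and> ?J (Suc k) (set_reg r_p (Suc k) s'')) s'"
    using J s' ki k assms(4) by (auto simp: init_token_def less_Suc_eq fun_eq_iff)
qed (use assms in \<open>auto simp: init_token_def frame_def\<close>)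

lemma wp_init_rows:
  assumes "reg s one = 1" "reg s r_n = n" "reg s r_l = L" "L < 2 ^ w" "n < 2 ^ w"
    and bnd: "\<And>i v. i < L \<Longrightarrow> v < n \<Longrightarrow> arr s a_weight i + v < 2 ^ w"
    and zero: "arr s a_root = (\<lambda>_. 0)" "arr s a_none = (\<lambda>_. 0)" "arr s a_some = (\<lambda>_. 0)"
  shows "wp w init_rows (\<lambda>t s'. arr s' a_root = (\<lambda>x. of_bool (x < n)) \<and>
     arr s' a_some = (\<lambda>x. of_bool (x < n)) \<and> (\<forall>v<n. arr s' a_row v = v) \<and>
     arr s' a_none = (\<lambda>x. of_bool (\<exists>v<n. \<exists>i<L. x = arr s a_weight i + v \<and> arr s a_token i = arr s a_color v)) \<and>
     frame {r_i, r_v, r_p, r_x, r_d} {a_root, a_some, a_none, a_row} s s' \<and>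
     t \<le> n * (8 + 7 * L) + 2) s"
  unfolding init_rows_def
proof (rule wp_For[where N = n and T = "\<lambda>_. 7 * L + 6" and J = "\<lambda>k s'.
     arr s' a_root = (\<lambda>x. of_bool (x < k)) \<and>
     arr s' a_some = (\<lambda>x. of_bool (x < k)) \<and> (\<forall>v<k. arr s' a_row v = v) \<and>
     arr s' a_none = (\<lambda>x. of_bool (\<exists>v<k. \<exists>i<L. x = arr s a_weight i + v \<and> arr s a_token i = arr s a_color v))"])
  let ?J = "\<lambda>k s'.
     arr s' a_root = (\<lambda>x. of_bool (x < k)) \<and>
     arr s' a_some = (\<lambda>x. of_bool (x < k)) \<and> (\<forall>v<k. arr s' a_row v = v) \<and>
     arr s' a_none = (\<lambda>x. of_bool (\<exists>v<k. \<exists>i<L. x = arr s a_weight i + v \<and> arr s a_token i = arr s a_color v))"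
  fix k s'
  assume k: "k < n" and J: "?J k s'" and ki: "reg s' r_i = k"
    and fr: "frame (insert r_i (regs_written init_row)) (arrs_written init_row) s s'"
  have s': "reg s' one = 1" "reg s' r_l = L"
      "arr s' a_weight = arr s a_weight" "arr s' a_token = arr s a_token" "arr s' a_color = arr s a_color"
    using fr assms by (auto simp: frame_def init_row_def init_token_def)
  let ?s = "set_reg r_v (arr s a_color k) (set_arr a_row k k (set_arr a_some k 1 (set_arr a_root k 1 s')))"
  have "wp w (For r_p r_l init_token)
     (\<lambda>t s''. 1 + (1 + (1 + (1 + t))) \<le> 7 * L + 6 \<and> ?J (Suc k) (set_reg r_i (Suc k) s'')) ?s"
  proof (rule wp_mono[OF wp_init_tokens[of ?s L]])
    fix t s''
    assume "arr s'' a_none = (\<lambda>x. if \<exists>i<L. x = arr ?s a_weight i + reg ?s r_i \<and> arr ?s a_token i = reg ?s r_v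
        then 1 else arr ?s a_none x) \<and> frame {r_p, r_x, r_d} {a_none} ?s s'' \<and> t \<le> 7 * L + 2"
    then show "1 + (1 + (1 + (1 + t))) \<le> 7 * L + 6 \<and> ?J (Suc k) (set_reg r_i (Suc k) s'')"
      using J s' ki by (auto simp: frame_def fun_eq_iff less_Suc_eq)
  qed (use s' ki k bnd assms in auto)
  then show "wp w init_row (\<lambda>t s''. t \<le> 7 * L + 6 \<and> ?J (Suc k) (set_reg r_i (Suc k) s'')) s'"
    using s' ki by (simp add: init_row_def)
qed (use assms in \<open>auto simp: init_row_def init_token_def frame_def fun_eq_iff\<close>)

section \<open>Reading the edges: degrees and neighbour sums\<close>

lemma wp_reduce:
  assumes "reg s r_n = n" "reg s r_x < 2 * n"
    and "\<And>t. t \<le> 2 \<Longrightarrow> Q t (set_reg r_x (reg s r_x mod n) s)"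
  shows "wp w reduce Q s"
proof -
  have "reg s r_x mod n = reg s r_x - n" if "n \<le> reg s r_x"
    using assms(2) that by (simp add: le_mod_geq)
  then show ?thesis
    using assms(1) assms(3)[of "Suc (Suc 0)"] by (auto simp: reduce_def)
qed

lemma wp_link:
  assumes "reg s one = 1" "reg s r_n = n" "a \<noteq> r_x" "b \<noteq> r_x"
    and "arr s a_deg (reg s a) + 1 < 2 ^ w" "arr s a_nbs (reg s a) < n" "reg s b < n" "2 * n < 2 ^ w"
  shows "wp w (link a b) (\<lambda>t s'. arr s' a_deg = (arr s a_deg)(reg s a := arr s a_deg (reg s a) + 1) \<and>
     arr s' a_nbs = (arr s a_nbs)(reg s a := (arr s a_nbs (reg s a) + reg s b) mod n) \<and>
     frame {r_x} {a_deg, a_nbs} s s' \<and> t \<le> 8) s"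
  using assms by (auto simp: link_def frame_def intro!: wp_reduce)

definition neighbours :: "(nat \<times> nat) set \<Rightarrow> nat \<Rightarrow> nat set" where
  "neighbours E v = {y. (v, y) \<in> E}"

text \<open>Each undirected edge is listed once and in one orientation, so every neighbour enters a
  degree and a sum exactly once.\<close>

lemma wp_read_edges:
  assumes "reg s one = 1" "reg s r_n = n" "reg s r_edges = length es" "length es < 2 ^ w" "2 * n < 2 ^ w"
    and es: "\<And>i. i < length es \<Longrightarrow> arr s a_src i = fst (es ! i) \<and> arr s a_dst i = snd (es ! i)"
    and zero: "arr s a_deg = (\<lambda>_. 0)" "arr s a_nbs = (\<lambda>_. 0)"
    and dist: "distinct es" "set es \<inter> (set es)\<inverse> = {}" and sub: "set es \<subseteq> {..<n} \<times> {..<n}"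
  shows "wp w read_edges (\<lambda>t s'.
     arr s' a_deg = (\<lambda>v. card (neighbours (set es \<union> (set es)\<inverse>) v)) \<and>
     arr s' a_nbs = (\<lambda>v. \<Sum>(neighbours (set es \<union> (set es)\<inverse>) v) mod n) \<and>
     frame {r_i, r_u, r_v, r_x} {a_deg, a_nbs} s s' \<and> t \<le> 20 * length es + 2) s"
  unfolding read_edges_def
proof (rule wp_For[where N = "length es" and T = "\<lambda>_. 18" and J = "\<lambda>k s'.
     arr s' a_deg = (\<lambda>v. card (neighbours (set (take k es) \<union> (set (take k es))\<inverse>) v)) \<and>
     arr s' a_nbs = (\<lambda>v. \<Sum>(neighbours (set (take k es) \<union> (set (take k es))\<inverse>) v) mod n)"])
  let ?E = "\<lambda>k. set (take k es) \<union> (set (take k es))\<inverse>"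
  let ?J = "\<lambda>k s'. arr s' a_deg = (\<lambda>v. card (neighbours (?E k) v)) \<and>
     arr s' a_nbs = (\<lambda>v. \<Sum>(neighbours (?E k) v) mod n)"
  fix k s'
  assume k: "k < length es" and J: "?J k s'" and ki: "reg s' r_i = k"
    and fr: "frame (insert r_i (regs_written read_edge)) (arrs_written read_edge) s s'"
  obtain a b where ab: "es ! k = (a, b)" by force
  have mem: "(a, b) \<in> set es" using k ab by (metis nth_mem)
  have a: "a < n" and b: "b < n" using mem sub by auto
  \<comment> \<open>A loop would be its own converse.\<close>
  have neq: "a \<noteq> b" using mem dist by auto
  have s': "reg s' one = 1" "reg s' r_n = n" "arr s' a_src k = a" "arr s' a_dst k = b"
    using fr assms(1,2) es[OF k] ab by (auto simp: frame_def read_edge_def link_def reduce_def)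
  have tk: "set (take k es) \<subseteq> set es" by (rule set_take_subset)
  have fresh: "(a, b) \<notin> ?E k" "(b, a) \<notin> ?E k"
  proof -
    have "distinct (take (Suc k) es)" using dist(1) by simp
    then have "(a, b) \<notin> set (take k es)" using k ab by (simp add: take_Suc_conv_app_nth)
    moreover have "(b, a) \<notin> set (take k es)" using mem tk dist(2) by auto
    ultimately show "(a, b) \<notin> ?E k" "(b, a) \<notin> ?E k" by auto
  qed
  have nb_sub: "neighbours (?E k) v \<subseteq> {..<n}" for v
    using tk sub by (auto simp: neighbours_def)
  have fin: "finite (neighbours (?E k) v)" for v using nb_sub finite_subset by blast
  have "card (neighbours (?E k) v) \<le> n" for v using card_mono[OF _ nb_sub] by simp
  then have deg: "card (neighbours (?E k) v) + 1 < 2 ^ w" for v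
    using assms(5) a by (rule_tac le_less_trans[of _ "n + 1"]) simp_all
  have ES: "?E (Suc k) = insert (a, b) (insert (b, a) (?E k))"
    using k ab by (auto simp: take_Suc_conv_app_nth)
  have nbS: "neighbours (?E (Suc k)) v = (if v = a then insert b (neighbours (?E k) a)
      else if v = b then insert a (neighbours (?E k) b) else neighbours (?E k) v)" for v
    unfolding ES neighbours_def using neq by auto
  have notin: "b \<notin> neighbours (?E k) a" "a \<notin> neighbours (?E k) b"
    using fresh by (simp_all add: neighbours_def)
  let ?s = "set_reg r_v b (set_reg r_u a s')"
  have "wp w (link r_u r_v ;; link r_v r_u)
    (\<lambda>t s''. 1 + (1 + t) \<le> 18 \<and> ?J (Suc k) (set_reg r_i (Suc k) s'')) ?s"
  proof (rule wp_SeqI, rule wp_link[of ?s n])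
    fix t :: nat and s1
    assume 1: "arr s1 a_deg = (arr ?s a_deg)(reg ?s r_u := arr ?s a_deg (reg ?s r_u) + 1) \<and>
     arr s1 a_nbs = (arr ?s a_nbs)(reg ?s r_u := (arr ?s a_nbs (reg ?s r_u) + reg ?s r_v) mod n) \<and>
     frame {r_x} {a_deg, a_nbs} ?s s1 \<and> t \<le> 8"
    then have s1: "reg s1 one = 1" "reg s1 r_n = n" "reg s1 r_u = a" "reg s1 r_v = b"
      using s' by (auto simp: frame_def)
    show "wp w (link r_v r_u) (\<lambda>u s''. 1 + (1 + (t + u)) \<le> 18 \<and> ?J (Suc k) (set_reg r_i (Suc k) s'')) s1"
    proof (rule wp_mono, rule wp_link[of s1 n])
      fix u :: nat and s2
      assume 2: "arr s2 a_deg = (arr s1 a_deg)(reg s1 r_v := arr s1 a_deg (reg s1 r_v) + 1) \<and>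
       arr s2 a_nbs = (arr s1 a_nbs)(reg s1 r_v := (arr s1 a_nbs (reg s1 r_v) + reg s1 r_u) mod n) \<and>
       frame {r_x} {a_deg, a_nbs} s1 s2 \<and> u \<le> 8"
      show "1 + (1 + (t + u)) \<le> 18 \<and> ?J (Suc k) (set_reg r_i (Suc k) s2)"
        using 1 2 J s1 neq notin fin
        by (auto simp: nbS fun_eq_iff mod_add_left_eq add.commute mod_add_right_eq)
    qed (use 1 s1 J deg a b neq assms(5) in auto)
  qed (use s' J deg a b assms(5) in auto)
  then show "wp w read_edge (\<lambda>t s''. t \<le> 18 \<and> ?J (Suc k) (set_reg r_i (Suc k) s'')) s'"
    using s' ki by (simp add: read_edge_def)
qed (use assms in \<open>auto simp: read_edge_def link_def reduce_def frame_def neighbours_def\<close>)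

section \<open>Merging rows\<close>

lemma wp_store_and:
  assumes "reg s one = 1"
    and "\<And>t s'. t \<le> 3 \<Longrightarrow> reg s' = reg s \<Longrightarrow> arr s' = (arr s)(a := (arr s a)(reg s r_d :=
      if reg s x = 1 \<and> reg s y = 1 then 1 else arr s a (reg s r_d))) \<Longrightarrow> Q t s'"
  shows "wp w (store_and a x y) Q s"
  using assms by (auto simp: store_and_def)

lemma wp_merge_stores:
  assumes "reg s one = 1" "reg s r_d = d"
  shows "wp w merge_stores (\<lambda>t s'. t \<le> 18 \<and>
    arr s' a_root = (arr s a_root)(d := if reg s 20 = 1 \<and> reg s 23 = 1 \<or> reg s 20 = 1 \<and> reg s 24 = 1
      then 1 else arr s a_root d) \<and>
    arr s' a_none = (arr s a_none)(d := if reg s 21 = 1 \<and> reg s 24 = 1 then 1 else arr s a_none d) \<and>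
    arr s' a_some = (arr s a_some)(d := if reg s 22 = 1 \<and> reg s 24 = 1 \<or>
      reg s 21 = 1 \<and> reg s 25 = 1 \<or> reg s 20 = 1 \<and> reg s 23 = 1 then 1 else arr s a_some d)) s"
proof -
  \<comment> \<open>Successive conditional writes to one cell collapse into a disjunction.\<close>
  have if_or: "(if a then x else if b then x else y) = (if b \<or> a then x else y)" for a b and x y :: nat
    by simp
  show ?thesis
    unfolding merge_stores_def wp_Seq
    by (rule wp_store_and, simp add: assms)+
      (simp add: assms if_or disj_ac cong: if_cong split del: if_split)
qed

lemma wp_merge_step:
  assumes "reg s one = 1"
    and l: "arr s a_left (reg s r_p) + reg s r_rowu = l" and r: "arr s a_right (reg s r_p) + reg s r_rowv = r"
    and d: "arr s a_left (reg s r_p) + arr s a_right (reg s r_p) + reg s r_next = d"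
    and bnd: "l < 2 ^ w" "r < 2 ^ w" "d < 2 ^ w"
  shows "wp w merge_step (\<lambda>t s'. t \<le> 30 \<and>
    arr s' a_root = (arr s a_root)(d := if arr s a_root l = 1 \<and> arr s a_root r = 1 \<or>
      arr s a_root l = 1 \<and> arr s a_none r = 1 then 1 else arr s a_root d) \<and>
    arr s' a_none = (arr s a_none)(d := if arr s a_none l = 1 \<and> arr s a_none r = 1
      then 1 else arr s a_none d) \<and>
    arr s' a_some = (arr s a_some)(d := if arr s a_some l = 1 \<and> arr s a_none r = 1 \<or>
      arr s a_none l = 1 \<and> arr s a_some r = 1 \<or> arr s a_root l = 1 \<and> arr s a_root r = 1
      then 1 else arr s a_some d)) s"
proof -
  have "arr s a_left (reg s r_p) + arr s a_right (reg s r_p) < 2 ^ w"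
    using d bnd by linarith
  then show ?thesis
    using assms unfolding merge_step_def
    by (simp split del: if_split) (rule wp_mono[OF wp_merge_stores]; simp add: add.assoc cong: if_cong split del: if_split)
qed

text \<open>No write resets a cell, so \<open>k\<close> conditional writes have this closed form,
  whatever their order.\<close>

definition written :: "nat \<Rightarrow> (nat \<Rightarrow> nat) \<Rightarrow> (nat \<Rightarrow> bool) \<Rightarrow> (nat \<Rightarrow> nat) \<Rightarrow> nat \<Rightarrow> nat" where
  "written k d P f = (\<lambda>x. if \<exists>p<k. x = d p \<and> P p then 1 else f x)"

lemma written_0 [simp]: "written 0 d P f = f"
  by (simp add: written_def)

lemma written_Suc:
  "(written k d P f)(d k := if P k then 1 else written k d P f (d k)) = written (Suc k) d P f"
  by (auto simp: written_def fun_eq_iff less_Suc_eq)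

lemma written_other: "(\<And>p. p < k \<Longrightarrow> x \<noteq> d p) \<Longrightarrow> written k d P f x = f x"
  by (auto simp: written_def)

text \<open>By \<open>sep\<close> no address is both read and written, so every test can be
  evaluated in the state before the loop.\<close>

lemma wp_merge_rows:
  fixes l r d :: "nat \<Rightarrow> nat"
  assumes "reg s one = 1" "reg s r_pairs = K" "K < 2 ^ w"
    and l: "\<And>p. arr s a_left p + reg s r_rowu = l p" and r: "\<And>p. arr s a_right p + reg s r_rowv = r p"
    and d: "\<And>p. arr s a_left p + arr s a_right p + reg s r_next = d p"
    and bnd: "\<And>p. p < K \<Longrightarrow> l p < 2 ^ w \<and> r p < 2 ^ w \<and> d p < 2 ^ w"
    and sep: "\<And>p q. p < K \<Longrightarrow> q < K \<Longrightarrow> l p \<noteq> d q \<and> r p \<noteq> d q"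
  shows "wp w (For r_p r_pairs merge_step) (\<lambda>t s'.
    arr s' a_root = written K d (\<lambda>p. arr s a_root (l p) = 1 \<and> arr s a_root (r p) = 1 \<or>
      arr s a_root (l p) = 1 \<and> arr s a_none (r p) = 1) (arr s a_root) \<and>
    arr s' a_none = written K d (\<lambda>p. arr s a_none (l p) = 1 \<and> arr s a_none (r p) = 1) (arr s a_none) \<and>
    arr s' a_some = written K d (\<lambda>p. arr s a_some (l p) = 1 \<and> arr s a_none (r p) = 1 \<or>
      arr s a_none (l p) = 1 \<and> arr s a_some (r p) = 1 \<or>
      arr s a_root (l p) = 1 \<and> arr s a_root (r p) = 1) (arr s a_some) \<and>
    frame {r_p, r_x, r_y, r_d, 20, 21, 22, 23, 24, 25} {a_root, a_none, a_some} s s' \<and>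
    t \<le> 32 * K + 2) s"
proof (rule wp_For[where N = K and T = "\<lambda>_. 30" and J = "\<lambda>k s'.
    arr s' a_root = written k d (\<lambda>p. arr s a_root (l p) = 1 \<and> arr s a_root (r p) = 1 \<or>
      arr s a_root (l p) = 1 \<and> arr s a_none (r p) = 1) (arr s a_root) \<and>
    arr s' a_none = written k d (\<lambda>p. arr s a_none (l p) = 1 \<and> arr s a_none (r p) = 1) (arr s a_none) \<and>
    arr s' a_some = written k d (\<lambda>p. arr s a_some (l p) = 1 \<and> arr s a_none (r p) = 1 \<or>
      arr s a_none (l p) = 1 \<and> arr s a_some (r p) = 1 \<or>
      arr s a_root (l p) = 1 \<and> arr s a_root (r p) = 1) (arr s a_some)"])
  let ?J = "\<lambda>k s'.
    arr s' a_root = written k d (\<lambda>p. arr s a_root (l p) = 1 \<and> arr s a_root (r p) = 1 \<or>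
      arr s a_root (l p) = 1 \<and> arr s a_none (r p) = 1) (arr s a_root) \<and>
    arr s' a_none = written k d (\<lambda>p. arr s a_none (l p) = 1 \<and> arr s a_none (r p) = 1) (arr s a_none) \<and>
    arr s' a_some = written k d (\<lambda>p. arr s a_some (l p) = 1 \<and> arr s a_none (r p) = 1 \<or>
      arr s a_none (l p) = 1 \<and> arr s a_some (r p) = 1 \<or>
      arr s a_root (l p) = 1 \<and> arr s a_root (r p) = 1) (arr s a_some)"
  fix k s'
  assume k: "k < K" and J: "?J k s'" and ki: "reg s' r_p = k"
    and fr: "frame (insert r_p (regs_written merge_step)) (arrs_written merge_step) s s'"
  have s': "reg s' one = 1" "reg s' r_rowu = reg s r_rowu" "reg s' r_rowv = reg s r_rowv"
    "reg s' r_next = reg s r_next" "arr s' a_left = arr s a_left" "arr s' a_right = arr s a_right"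
    using fr assms(1) by (auto simp: frame_def merge_step_def merge_stores_def store_and_def)
  have old: "written k d P f (l k) = f (l k)" "written k d P f (r k) = f (r k)" for P f
    by (rule written_other; use sep[OF k] k in \<open>meson less_trans\<close>)+
  show "wp w merge_step (\<lambda>t s''. t \<le> 30 \<and> ?J (Suc k) (set_reg r_p (Suc k) s'')) s'"
    by (rule wp_mono[OF wp_merge_step[of s' "l k" "r k" "d k"]])
      (use s' ki l r d bnd[OF k] J old in \<open>auto simp: written_Suc[symmetric]\<close>)
qed (use assms in \<open>auto simp: merge_step_def merge_stores_def store_and_def frame_def\<close>)

text \<open>A pair writes to the entry of \<open>m\<close> exactly if its codes add up to the code
  of \<open>m\<close>; for disjoint sets this means that they partition \<open>m\<close>. This links
  the writes of a merge to the splittings in the merge lemmas.\<close>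

lemma pair_codes_ex:
  assumes l: "(\<lambda>p. (l p, r p)) ` {..<K} = pair_codes W L" and W: "0 < W" and m: "m \<subseteq> {..<L}"
  shows "(\<exists>p<K. j + W * set_encode m = l p + r p + j \<and> P (l p) (r p)) \<longleftrightarrow>
    (\<exists>a b. a \<union> b = m \<and> a \<inter> b = {} \<and> P (W * set_encode a) (W * set_encode b))" (is "?L \<longleftrightarrow> ?R")
proof
  assume ?L
  then obtain p where p: "p < K" "W * set_encode m = l p + r p" "P (l p) (r p)" by auto
  have "(l p, r p) \<in> pair_codes W L" unfolding l[symmetric] using p(1) by blast
  then obtain a b where ab: "l p = W * set_encode a" "r p = W * set_encode b"
    "a \<subseteq> {..<L}" "b \<subseteq> {..<L}" "a \<inter> b = {}" by (auto simp: pair_codes_def)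
  have fin: "finite a" "finite b" "finite m" using ab m finite_subset by blast+
  have "W * set_encode m = W * set_encode (a \<union> b)"
    using p(2) ab set_encode_Un[OF fin(1,2)] by (simp add: distrib_left)
  then have "a \<union> b = m" using W fin by (simp add: set_encode_eq_iff)
  moreover have "P (W * set_encode a) (W * set_encode b)" using p(3) ab(1,2) by simp
  ultimately show ?R using ab(5) by (intro exI[of _ a] exI[of _ b] conjI)
next
  assume ?R
  then obtain a b where ab: "a \<union> b = m" "a \<inter> b = {}" "P (W * set_encode a) (W * set_encode b)" by blast
  have sub: "a \<subseteq> {..<L}" "b \<subseteq> {..<L}" using ab(1) m by auto
  have "(W * set_encode a, W * set_encode b) \<in> pair_codes W L" by (rule pair_codesI[OF sub ab(2)])
  then obtain p where p: "p < K" "l p = W * set_encode a" "r p = W * set_encode b"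
    unfolding l[symmetric] by auto
  have "finite a" "finite b" using sub finite_subset by blast+
  then have "set_encode m = set_encode a + set_encode b"
    using set_encode_Un[of a b] ab(1,2) by simp
  then have "W * set_encode m = l p + r p" using p by (simp add: distrib_left)
  then show ?L using p ab(3) by (intro exI[of _ p]) simp
qed

text \<open>The row number is the remainder of the address modulo \<open>W\<close>, so different
  rows never share an address.\<close>

lemma row_address_eq_iff:
  fixes j j' W e e' :: nat
  assumes "j < W" "j' < W"
  shows "j + W * e = j' + W * e' \<longleftrightarrow> j = j' \<and> e = e'"
proof
  assume eq: "j + W * e = j' + W * e'"
  have "j = (j + W * e) mod W" "j' = (j' + W * e') mod W" using assms by simp_all
  then have "j = j'" using eq by metis
  then show "j = j' \<and> e = e'" using eq assms by simp
qed simp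

section \<open>Stripping leaves\<close>

locale motif_tree = surplus_tokens E \<chi> tok
  for E :: "(nat \<times> nat) set" and \<chi> tok :: "nat \<Rightarrow> nat" +
  fixes n L :: nat
  assumes symE: "sym E" and irreflE: "irrefl E" and acyclicE: "acyclic_graph E"
    and connE: "cut_connected E {..<n}"
begin

lemma n_pos: "0 < n"
  using connE by (cases n) (auto simp: cut_connected_def)

definition row_ok :: "state \<Rightarrow> nat \<Rightarrow> nat set \<Rightarrow> nat \<Rightarrow> bool" where
  "row_ok s j B r \<longleftrightarrow> (\<forall>m\<subseteq>{..<L}.
     arr s a_root (j + 2 * n * set_encode m) = of_bool (root_kept B r m) \<and>
     arr s a_none (j + 2 * n * set_encode m) = of_bool (none_kept B m) \<and>
     arr s a_some (j + 2 * n * set_encode m) = of_bool (some_kept B m))"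

definition row_clear :: "state \<Rightarrow> nat \<Rightarrow> bool" where
  "row_clear s j \<longleftrightarrow> (\<forall>m\<subseteq>{..<L}. arr s a_root (j + 2 * n * set_encode m) = 0 \<and>
     arr s a_none (j + 2 * n * set_encode m) = 0 \<and> arr s a_some (j + 2 * n * set_encode m) = 0)"

text \<open>\<open>bag r\<close> is the set of vertices that have been merged into the surviving vertex \<open>r\<close>.\<close>

definition bags_ok :: "nat set \<Rightarrow> (nat \<Rightarrow> nat set) \<Rightarrow> bool" where
  "bags_ok R bag \<longleftrightarrow> R \<subseteq> {..<n} \<and> cut_connected E R \<and> (\<forall>r\<in>R. r \<in> bag r) \<and> \<Union>(bag ` R) = {..<n} \<and>
     (\<forall>r\<in>R. \<forall>r'\<in>R. r \<noteq> r' \<longrightarrow> bag r \<inter> bag r' = {} \<and>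
        (\<forall>x\<in>bag r. \<forall>y\<in>bag r'. (x, y) \<in> E \<longrightarrow> x = r \<and> y = r'))"

text \<open>The first conjunct counts rows: \<open>n\<close> are in use at the start, and every
  merge spends one row and removes one vertex. The clause with \<open>Suc\<close> says that the last
  row in use belongs to a survivor, which locates the answer at the end.\<close>

definition tables_ok :: "nat set \<Rightarrow> (nat \<Rightarrow> nat set) \<Rightarrow> state \<Rightarrow> bool" where
  "tables_ok R bag s \<longleftrightarrow> reg s r_next + card R = 2 * n \<and>
     (\<forall>r\<in>R. arr s a_row r < reg s r_next \<and> row_ok s (arr s a_row r) (bag r) r) \<and>
     (\<exists>r\<in>R. Suc (arr s a_row r) = reg s r_next) \<and>
     (\<forall>j. reg s r_next \<le> j \<longrightarrow> j < 2 * n \<longrightarrow> row_clear s j)"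

text \<open>The scan also visits removed vertices, so their degrees are specified too; neighbour
  sums are read for survivors only.\<close>

definition degrees_ok :: "nat set \<Rightarrow> state \<Rightarrow> bool" where
  "degrees_ok R s \<longleftrightarrow>
     (\<forall>v<n. arr s a_deg v = (if v \<in> R then card (neighbours E v \<inter> R) else 0)) \<and>
     (\<forall>v\<in>R. arr s a_nbs v = \<Sum>(neighbours E v \<inter> R) mod n)"

definition static :: "nat \<Rightarrow> state \<Rightarrow> bool" where
  "static w s \<longleftrightarrow> reg s one = 1 \<and> reg s zero = 0 \<and> reg s r_n = n \<and> reg s r_pairs = 3 ^ L \<and>
     pair_set s (3 ^ L) = pair_codes (2 * n) L \<and> 4 * (3 ^ L * n) < 2 ^ w"

section \<open>Invariants under the removal of a leaf\<close>

lemma bags_okD: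
  assumes "bags_ok R bag"
  shows "r \<in> R \<Longrightarrow> r \<in> bag r"
    and "r \<in> R \<Longrightarrow> r' \<in> R \<Longrightarrow> r \<noteq> r' \<Longrightarrow> bag r \<inter> bag r' = {}"
    and "r \<in> R \<Longrightarrow> r' \<in> R \<Longrightarrow> r \<noteq> r' \<Longrightarrow> x \<in> bag r \<Longrightarrow> y \<in> bag r' \<Longrightarrow> (x, y) \<in> E \<Longrightarrow> x = r \<and> y = r'"
proof -
  note mem = assms[unfolded bags_ok_def, THEN conjunct2, THEN conjunct2, THEN conjunct1]
  note cross = assms[unfolded bags_ok_def, THEN conjunct2, THEN conjunct2, THEN conjunct2, THEN conjunct2]
  show "r \<in> R \<Longrightarrow> r \<in> bag r" using mem by (rule bspec)
  assume r: "r \<in> R" "r' \<in> R" "r \<noteq> r'"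
  note c = cross[THEN bspec, OF r(1), THEN bspec, OF r(2), THEN mp, OF r(3)]
  show "bag r \<inter> bag r' = {}" by (rule conjunct1[OF c])
  show "x \<in> bag r \<Longrightarrow> y \<in> bag r' \<Longrightarrow> (x, y) \<in> E \<Longrightarrow> x = r \<and> y = r'"
    using conjunct2[OF c] by blast
qed

lemma bags_ok_finite:
  assumes "bags_ok R bag" shows "finite R" and "r \<in> R \<Longrightarrow> finite (bag r)"
proof -
  show "finite R" using assms finite_subset[of R "{..<n}"] by (simp add: bags_ok_def)
  show "finite (bag r)" if "r \<in> R"
  proof -
    have "\<Union>(bag ` R) = {..<n}" using assms by (simp add: bags_ok_def)
    then have "bag r \<subseteq> {..<n}" using that by blast
    then show ?thesis using finite_subset by blast
  qed
qed

text \<open>An edge from the bag of \<open>v\<close> to another bag starts in \<open>v\<close> and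
  ends in a representative, hence in \<open>u\<close>. So the enlarged bag can still be left only at
  \<open>u\<close>.\<close>

lemma bags_ok_merge:
  assumes b: "bags_ok R bag" and v: "v \<in> R" and nb: "neighbours E v \<inter> R = {u}"
  shows "bags_ok (R - {v}) (bag(u := bag u \<union> bag v))"
proof -
  have u: "u \<in> R" "(v, u) \<in> E" "u \<noteq> v"
    using nb irreflE by (auto simp: neighbours_def irrefl_def)
  have only: "y = u" if "y \<in> R" "(v, y) \<in> E \<or> (y, v) \<in> E" for y
    using that nb symE by (auto simp: neighbours_def dest: symD)
  note cross = bags_okD(2,3)[OF b]
  show ?thesis
    unfolding bags_ok_def
  proof (intro conjI)
    show "R - {v} \<subseteq> {..<n}" using b by (auto simp only: bags_ok_def)
    show "cut_connected E (R - {v})"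
    proof (rule cut_connected_remove_leaf[OF _ v u(1,3) _ symE])
      show "cut_connected E R" using b by (simp add: bags_ok_def)
      show "{y \<in> R. (v, y) \<in> E} = {u}" using nb by (auto simp: neighbours_def)
    qed
    show "\<forall>r\<in>R - {v}. r \<in> (bag(u := bag u \<union> bag v)) r"
      using b unfolding bags_ok_def by simp
    have "\<Union>((bag(u := bag u \<union> bag v)) ` (R - {v})) = \<Union>(bag ` R)"
    proof -
      have "\<Union>(bag ` R) = bag u \<union> bag v \<union> \<Union>(bag ` (R - {v} - {u}))" using u v by blast
      moreover have "\<Union>((bag(u := bag u \<union> bag v)) ` (R - {v})) =
          bag u \<union> bag v \<union> \<Union>(bag ` (R - {v} - {u}))" using u v by auto
      ultimately show ?thesis by simp
    qed
    then show "\<Union>((bag(u := bag u \<union> bag v)) ` (R - {v})) = {..<n}"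
      using b by (simp add: bags_ok_def)
    show "\<forall>r\<in>R - {v}. \<forall>r'\<in>R - {v}. r \<noteq> r' \<longrightarrow>
        (bag(u := bag u \<union> bag v)) r \<inter> (bag(u := bag u \<union> bag v)) r' = {} \<and>
        (\<forall>x\<in>(bag(u := bag u \<union> bag v)) r. \<forall>y\<in>(bag(u := bag u \<union> bag v)) r'. (x, y) \<in> E \<longrightarrow> x = r \<and> y = r')"
    proof (intro ballI impI)
      fix r r' assume r: "r \<in> R - {v}" "r' \<in> R - {v}" "r \<noteq> r'"
      let ?bag = "bag(u := bag u \<union> bag v)"
      have disj: "bag v \<inter> bag r' = {}" "bag r \<inter> bag v = {}" "bag r \<inter> bag r' = {}"
        using cross(1)[of v r'] cross(1)[of r v] cross(1)[of r r'] r v by simp_all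
      have "?bag r \<inter> ?bag r' = {}"
        using disj r by (cases "r = u"; cases "r' = u") (simp_all add: Int_Un_distrib Int_Un_distrib2)
      moreover have "x = r \<and> y = r'" if xy: "x \<in> ?bag r" "y \<in> ?bag r'" "(x, y) \<in> E" for x y
      proof -
        have "x \<in> bag r \<or> r = u \<and> x \<in> bag v" "y \<in> bag r' \<or> r' = u \<and> y \<in> bag v"
          using xy by (simp_all split: if_splits)
        then consider "x \<in> bag r" "y \<in> bag r'" | "r = u" "x \<in> bag v" "y \<in> bag r'"
          | "r' = u" "x \<in> bag r" "y \<in> bag v"
          using r(3) by metis
        then show ?thesis
        proof cases
          case 1
          then show ?thesis using cross(2)[of r r' x y] xy r by simp
        next
          case 2
          then have "x = v \<and> y = r'" using cross(2)[of v r' x y] xy r v by simp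
          then show ?thesis using only[of r'] xy r 2 by simp
        next
          case 3
          then have "x = r \<and> y = v" using cross(2)[of r v x y] xy r v by simp
          then show ?thesis using only[of r] xy r 3 by simp
        qed
      qed
      ultimately show "?bag r \<inter> ?bag r' = {} \<and>
        (\<forall>x\<in>?bag r. \<forall>y\<in>?bag r'. (x, y) \<in> E \<longrightarrow> x = r \<and> y = r')"
        by simp
    qed
  qed
qed

lemma degrees_ok_remove:
  assumes d: "degrees_ok R s" and R: "R \<subseteq> {..<n}" and v: "v \<in> R" and nb: "neighbours E v \<inter> R = {u}"
    and s': "arr s' a_deg = (arr s a_deg)(v := 0, u := arr s a_deg u - 1)"
    "arr s' a_nbs = (arr s a_nbs)(u := (arr s a_nbs u + n - v) mod n)"
  shows "degrees_ok (R - {v}) s'"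
proof -
  have u: "u \<in> R" "(v, u) \<in> E" "u \<noteq> v"
    using nb irreflE by (auto simp: neighbours_def irrefl_def)
  have vu: "v \<in> neighbours E u" using u symE by (auto simp: neighbours_def dest: symD)
  have finR: "finite R" using R finite_subset by blast
  have same: "neighbours E r \<inter> (R - {v}) = neighbours E r \<inter> R" if "r \<in> R" "r \<noteq> u" for r
    using that nb symE by (auto simp: neighbours_def dest: symD)
  have eq: "neighbours E u \<inter> (R - {v}) = neighbours E u \<inter> R - {v}" by blast
  have vin: "v \<in> neighbours E u \<inter> R" using vu v by simp
  have card: "card (neighbours E u \<inter> (R - {v})) = card (neighbours E u \<inter> R) - 1"
    unfolding eq using vin by (rule card_Diff_singleton)
  have "\<Sum>(neighbours E u \<inter> R) = v + \<Sum>(neighbours E u \<inter> (R - {v}))"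
    unfolding eq using vin finR by (intro sum.remove) auto
  moreover have "arr s a_nbs u = \<Sum>(neighbours E u \<inter> R) mod n" "v < n"
    using d u v R by (auto simp: degrees_ok_def)
  ultimately have "(arr s a_nbs u + n - v) mod n = \<Sum>(neighbours E u \<inter> (R - {v})) mod n"
  proof -
    let ?S = "\<Sum>(neighbours E u \<inter> (R - {v}))"
    assume a: "\<Sum>(neighbours E u \<inter> R) = v + ?S" "arr s a_nbs u = \<Sum>(neighbours E u \<inter> R) mod n" "v < n"
    \<comment> \<open>Adding \<open>n - v\<close> instead of subtracting \<open>v\<close> stays
      within the natural numbers and agrees modulo \<open>n\<close>.\<close>
    have "(arr s a_nbs u + n - v) mod n = ((v + ?S) mod n + (n - v)) mod n" using a by simp
    also have "\<dots> = (v + ?S + (n - v)) mod n" by (rule mod_add_left_eq)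
    also have "v + ?S + (n - v) = ?S + n" using a(3) by simp
    finally show ?thesis by simp
  qed
  then show ?thesis
    using d u v card same R unfolding degrees_ok_def s' by auto
qed

text \<open>Row \<open>j\<close> is clear beforehand, so an entry becomes 1 exactly if some pair
  writes it. By \<open>pair_codes_ex\<close> such pairs are the splittings of \<open>m\<close>, to
  which the three merge lemmas apply.\<close>

lemma row_ok_merge:
  assumes b: "bags_ok R bag" and v: "v \<in> R" and nb: "neighbours E v \<inter> R = {u}"
    and lr: "(\<lambda>p. (l p, r p)) ` {..<K} = pair_codes (2 * n) L"
    and u_ok: "row_ok s ru (bag u) u" and v_ok: "row_ok s rv (bag v) v" and clear: "row_clear s j"
    and s': "arr s' a_root = written K (\<lambda>p. l p + r p + j) (\<lambda>p. arr s a_root (l p + ru) = 1 \<and> arr s a_root (r p + rv) = 1 \<or>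
      arr s a_root (l p + ru) = 1 \<and> arr s a_none (r p + rv) = 1) (arr s a_root)"
    "arr s' a_none = written K (\<lambda>p. l p + r p + j) (\<lambda>p. arr s a_none (l p + ru) = 1 \<and>
      arr s a_none (r p + rv) = 1) (arr s a_none)"
    "arr s' a_some = written K (\<lambda>p. l p + r p + j) (\<lambda>p. arr s a_some (l p + ru) = 1 \<and> arr s a_none (r p + rv) = 1 \<or>
      arr s a_none (l p + ru) = 1 \<and> arr s a_some (r p + rv) = 1 \<or>
      arr s a_root (l p + ru) = 1 \<and> arr s a_root (r p + rv) = 1) (arr s a_some)"
  shows "row_ok s' j (bag u \<union> bag v) u"
  unfolding row_ok_def
proof (intro allI impI)
  fix m assume m: "m \<subseteq> {..<L}"
  have u: "u \<in> R" "(v, u) \<in> E" "u \<noteq> v"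
    using nb irreflE by (auto simp: neighbours_def irrefl_def)
  have uv: "(u, v) \<in> E" using u symE by (auto dest: symD)
  note inb = bags_okD(1)[OF b u(1)] bags_okD(1)[OF b v]
  note disj = bags_okD(2)[OF b u(1) v u(3)]
  have bridge: "\<forall>x\<in>bag u. \<forall>y\<in>bag v. (x, y) \<in> E \<longrightarrow> x = u \<and> y = v"
    using bags_okD(3)[OF b u(1) v u(3)] by simp
  have finm: "finite m" using m finite_subset by blast
  note ctx = bags_ok_finite(2)[OF b u(1)] bags_ok_finite(2)[OF b v] finm disj inb uv symE bridge
  have rows: "arr s a_root (2 * n * set_encode a + ru) = of_bool (root_kept (bag u) u a)"
      "arr s a_none (2 * n * set_encode a + ru) = of_bool (none_kept (bag u) a)"
      "arr s a_some (2 * n * set_encode a + ru) = of_bool (some_kept (bag u) a)"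
      "arr s a_root (2 * n * set_encode a + rv) = of_bool (root_kept (bag v) v a)"
      "arr s a_none (2 * n * set_encode a + rv) = of_bool (none_kept (bag v) a)"
      "arr s a_some (2 * n * set_encode a + rv) = of_bool (some_kept (bag v) a)"
    if "a \<subseteq> m" for a
    using u_ok v_ok subset_trans[OF that m] by (auto simp: row_ok_def add.commute)
  have P: "0 < 2 * n" using n_pos by simp
  note ex = pair_codes_ex[OF lr P m, of j]
  let ?x = "j + 2 * n * set_encode m"
  have z: "arr s a_root ?x = 0" "arr s a_none ?x = 0" "arr s a_some ?x = 0"
    using clear m by (auto simp: row_clear_def)
  have sub: "(\<exists>a b. a \<union> b = m \<and> a \<inter> b = {} \<and> P a b) \<longleftrightarrow> (\<exists>a b. a \<union> b = m \<and> a \<inter> b = {} \<and> Q a b)"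
    if "\<And>a b. a \<subseteq> m \<Longrightarrow> b \<subseteq> m \<Longrightarrow> P a b \<longleftrightarrow> Q a b" for P Q :: "nat set \<Rightarrow> nat set \<Rightarrow> bool"
    using that by (metis Un_upper1 Un_upper2)
  have root: "(\<exists>p<K. ?x = l p + r p + j \<and> (arr s a_root (l p + ru) = 1 \<and> arr s a_root (r p + rv) = 1 \<or>
      arr s a_root (l p + ru) = 1 \<and> arr s a_none (r p + rv) = 1)) \<longleftrightarrow> root_kept (bag u \<union> bag v) u m"
    unfolding ex[of "\<lambda>x y. arr s a_root (x + ru) = 1 \<and> arr s a_root (y + rv) = 1 \<or>
      arr s a_root (x + ru) = 1 \<and> arr s a_none (y + rv) = 1"]
      root_kept_merge[OF ctx]
    by (rule sub) (auto simp: rows)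
  have none: "(\<exists>p<K. ?x = l p + r p + j \<and> arr s a_none (l p + ru) = 1 \<and>
      arr s a_none (r p + rv) = 1) \<longleftrightarrow> none_kept (bag u \<union> bag v) m"
    unfolding ex[of "\<lambda>x y. arr s a_none (x + ru) = 1 \<and> arr s a_none (y + rv) = 1"]
      none_kept_merge[OF ctx]
    by (rule sub) (auto simp: rows)
  have some: "(\<exists>p<K. ?x = l p + r p + j \<and> (arr s a_some (l p + ru) = 1 \<and> arr s a_none (r p + rv) = 1 \<or>
      arr s a_none (l p + ru) = 1 \<and> arr s a_some (r p + rv) = 1 \<or>
      arr s a_root (l p + ru) = 1 \<and> arr s a_root (r p + rv) = 1)) \<longleftrightarrow> some_kept (bag u \<union> bag v) m"
    unfolding ex[of "\<lambda>x y. arr s a_some (x + ru) = 1 \<and> arr s a_none (y + rv) = 1 \<or>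
      arr s a_none (x + ru) = 1 \<and> arr s a_some (y + rv) = 1 \<or>
      arr s a_root (x + ru) = 1 \<and> arr s a_root (y + rv) = 1"]
      some_kept_merge[OF ctx]
    by (rule sub) (auto simp: rows)
  show "arr s' a_root ?x = of_bool (root_kept (bag u \<union> bag v) u m) \<and>
     arr s' a_none ?x = of_bool (none_kept (bag u \<union> bag v) m) \<and>
     arr s' a_some ?x = of_bool (some_kept (bag u \<union> bag v) m)"
    unfolding s' written_def root none some using z by simp
qed

end

context motif_tree
begin

text \<open>Sums of codes are multiples of the stride, so all writes of a merge stay within row
  \<open>j\<close>.\<close>

lemma written_other_row:
  assumes "(\<lambda>p. (l p, r p)) ` {..<K} = pair_codes (2 * n) L" "i < 2 * n" "j < 2 * n" "i \<noteq> j"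
  shows "written K (\<lambda>p. l p + r p + j) P f (i + 2 * n * e) = f (i + 2 * n * e)"
proof (rule written_other)
  fix p assume "p < K"
  then have "(l p, r p) \<in> pair_codes (2 * n) L" unfolding assms(1)[symmetric] by blast
  then obtain a b where "l p = 2 * n * set_encode a" "r p = 2 * n * set_encode b"
    by (auto simp: pair_codes_def)
  then have "l p + r p + j = j + 2 * n * (set_encode a + set_encode b)" by (simp add: distrib_left)
  then show "i + 2 * n * e \<noteq> l p + r p + j"
    using row_address_eq_iff[OF assms(2,3)] assms(4) by metis
qed

lemma tables_ok_merge:
  assumes b: "bags_ok R bag" and t: "tables_ok R bag s" and v: "v \<in> R" and nb: "neighbours E v \<inter> R = {u}"
    and lr: "(\<lambda>p. (l p, r p)) ` {..<K} = pair_codes (2 * n) L"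
    and j: "reg s r_next = j" "arr s a_row u = ru" "arr s a_row v = rv"
    and tabs: "arr s' a_root = written K (\<lambda>p. l p + r p + j) (\<lambda>p. arr s a_root (l p + ru) = 1 \<and> arr s a_root (r p + rv) = 1 \<or>
      arr s a_root (l p + ru) = 1 \<and> arr s a_none (r p + rv) = 1) (arr s a_root)"
    "arr s' a_none = written K (\<lambda>p. l p + r p + j) (\<lambda>p. arr s a_none (l p + ru) = 1 \<and>
      arr s a_none (r p + rv) = 1) (arr s a_none)"
    "arr s' a_some = written K (\<lambda>p. l p + r p + j) (\<lambda>p. arr s a_some (l p + ru) = 1 \<and> arr s a_none (r p + rv) = 1 \<or>
      arr s a_none (l p + ru) = 1 \<and> arr s a_some (r p + rv) = 1 \<or>
      arr s a_root (l p + ru) = 1 \<and> arr s a_root (r p + rv) = 1) (arr s a_some)"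
    and s': "arr s' a_row = (arr s a_row)(u := j)" "reg s' r_next = Suc j"
  shows "tables_ok (R - {v}) (bag(u := bag u \<union> bag v)) s'"
proof -
  have u: "u \<in> R" "u \<noteq> v"
    using nb irreflE by (auto simp: neighbours_def irrefl_def)
  have fin: "finite R" by (rule bags_ok_finite[OF b])
  have cR: "0 < card R" using fin v by (auto simp: card_gt_0_iff)
  have sum: "j + card R = 2 * n" using t j by (simp add: tables_ok_def)
  then have jn: "j < 2 * n" using cR by linarith
  have rows: "arr s a_row r < j \<and> row_ok s (arr s a_row r) (bag r) r" if "r \<in> R" for r
    using t that j by (simp add: tables_ok_def)
  have clear: "row_clear s i" if "j \<le> i" "i < 2 * n" for i
    using t that j by (simp add: tables_ok_def)
  have unchanged: "arr s' a_root (i + 2 * n * e) = arr s a_root (i + 2 * n * e) \<and>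
      arr s' a_none (i + 2 * n * e) = arr s a_none (i + 2 * n * e) \<and>
      arr s' a_some (i + 2 * n * e) = arr s a_some (i + 2 * n * e)" if "i < 2 * n" "i \<noteq> j" for i e
    unfolding tabs using written_other_row[OF lr that(1) jn that(2)] by simp
  have new: "row_ok s' j (bag u \<union> bag v) u"
    by (rule row_ok_merge[OF b v nb lr _ _ clear[OF order_refl jn] tabs])
      (use rows[OF u(1)] rows[OF v] j in auto)
  have other: "arr s' a_row r < Suc j \<and> row_ok s' (arr s' a_row r) (bag r) r" if "r \<in> R" "r \<noteq> u" for r
  proof -
    have "arr s' a_row r = arr s a_row r" using s' that by simp
    moreover have "arr s a_row r < 2 * n" "arr s a_row r \<noteq> j" using rows[OF that(1)] jn by auto
    ultimately show ?thesis
      using rows[OF that(1)] unchanged[of "arr s a_row r"] unfolding row_ok_def by simp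
  qed
  show ?thesis
    unfolding tables_ok_def
  proof (intro conjI)
    show "reg s' r_next + card (R - {v}) = 2 * n"
      using s' sum v fin cR by simp
    show "\<forall>r\<in>R - {v}. arr s' a_row r < reg s' r_next \<and>
        row_ok s' (arr s' a_row r) ((bag(u := bag u \<union> bag v)) r) r"
      using other new s' by auto
    show "\<exists>r\<in>R - {v}. Suc (arr s' a_row r) = reg s' r_next"
      using u s' by (intro bexI[of _ u]) auto
    show "\<forall>i. reg s' r_next \<le> i \<longrightarrow> i < 2 * n \<longrightarrow> row_clear s' i"
      using clear unchanged s' unfolding row_clear_def by simp
  qed
qed

lemma pair_code_cases:
  assumes "(x, y) \<in> pair_codes W L"
  obtains e f where "x = W * e" "y = W * f" "x + y + W \<le> W * 2 ^ L"
  using assms pair_codes_bound[OF assms] by (auto simp: pair_codes_def)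

text \<open>Compares the extent of the tables with the quantity that the word length is known to
  exceed.\<close>

lemma pow_bound: "2 * n * 2 ^ L \<le> 2 * (3 ^ L * n)"
  by (simp add: power_mono)

section \<open>Correctness and cost of one merge\<close>

lemma wp_remove_leaf:
  assumes "reg s one = 1" "reg s zero = 0" "reg s r_n = n" "reg s r_u = u" "reg s r_v = v"
    and "u \<noteq> v" "reg s r_next = j" "Suc j < 2 ^ w" "arr s a_nbs u < n" "2 * n < 2 ^ w"
  shows "wp w remove_leaf (\<lambda>t s'. t \<le> 14 \<and> frame {r_next, r_x, r_v} {a_row, a_deg, a_nbs} s s' \<and>
     reg s' r_next = Suc j \<and> reg s' r_v = u \<and> arr s' a_row = (arr s a_row)(u := j) \<and>
     arr s' a_deg = (arr s a_deg)(v := 0, u := arr s a_deg u - 1) \<and>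
     arr s' a_nbs = (arr s a_nbs)(u := (arr s a_nbs u + n - v) mod n)) s"
  unfolding remove_leaf_def using assms
  by (auto simp: frame_def intro!: wp_reduce[of _ n])

text \<open>Three loads, at most \<open>32 * 3 ^ L + 2\<close> steps for the rows and at most 14 for
  the removal fit into \<open>52 * 3 ^ L\<close>, as \<open>3 ^ L\<close> is at least 1.\<close>

lemma wp_eliminate:
  assumes st: "static w s" and b: "bags_ok R bag" and tb: "tables_ok R bag s" and d: "degrees_ok R s"
    and v: "reg s r_v = v" "v \<in> R" "arr s a_deg v = 1"
  shows "wp w eliminate (\<lambda>t s'. \<exists>u. neighbours E v \<inter> R = {u} \<and>
     tables_ok (R - {v}) (bag(u := bag u \<union> bag v)) s' \<and> degrees_ok (R - {v}) s' \<and>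
     reg s' r_v = u \<and> reg s' r_next = Suc (reg s r_next) \<and> t \<le> 52 * 3 ^ L) s"
proof -
  have R: "R \<subseteq> {..<n}" using b by (simp add: bags_ok_def)
  have "card (neighbours E v \<inter> R) = 1" using d v R by (auto simp: degrees_ok_def)
  then obtain u where nb: "neighbours E v \<inter> R = {u}" by (rule card_1_singletonE)
  have u: "u \<in> R" "u \<noteq> v"
    using nb irreflE by (auto simp: neighbours_def irrefl_def)
  have un: "u < n" "v < n" using u v R by auto
  \<comment> \<open>A one-element sum modulo \<open>n\<close> is the neighbour itself, as vertices
    are below \<open>n\<close>.\<close>
  have nbs: "arr s a_nbs v = u" using d v nb un by (simp add: degrees_ok_def)
  define ru where "ru = arr s a_row u"
  define rv where "rv = arr s a_row v"
  define j where "j = reg s r_next"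
  have "finite R" by (rule bags_ok_finite[OF b])
  then have cR: "0 < card R" using u by (auto simp: card_gt_0_iff)
  have "j + card R = 2 * n" using tb by (simp add: tables_ok_def j_def)
  then have jn: "j < 2 * n" using cR by linarith
  have rj: "ru < j" "rv < j" using tb u v by (auto simp: tables_ok_def ru_def rv_def j_def)
  let ?K = "3 ^ L :: nat"
  define l where "l = arr s a_left"
  define r where "r = arr s a_right"
  have lr: "(\<lambda>p. (l p, r p)) ` {..<?K} = pair_codes (2 * n) L"
    using st by (simp add: static_def pair_set_def l_def r_def)
  have big: "4 * (?K * n) < 2 ^ w" and sreg: "reg s one = 1" "reg s zero = 0" "reg s r_n = n" "reg s r_pairs = ?K"
    using st by (simp_all add: static_def)
  have "n \<le> ?K * n" "?K \<le> ?K * n" using n_pos by simp_all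
  then have Kw: "?K < 2 ^ w" and nw: "2 * n < 2 ^ w" using big by linarith+
  have code: "\<exists>e f. l p = 2 * n * e \<and> r p = 2 * n * f \<and> l p + r p + 2 * n < 2 ^ w" if "p < ?K" for p
  proof -
    have "(l p, r p) \<in> pair_codes (2 * n) L" unfolding lr[symmetric] using that by blast
    then obtain e f where "l p = 2 * n * e" "r p = 2 * n * f" "l p + r p + 2 * n \<le> 2 * n * 2 ^ L"
      by (rule pair_code_cases)
    then show ?thesis using pow_bound big by (intro exI[of _ e] exI[of _ f]) linarith
  qed
  let ?s1 = "set_reg r_rowv rv (set_reg r_rowu ru (set_reg r_u u s))"
  have "wp w (For r_p r_pairs merge_step) (\<lambda>t s'.
    arr s' a_root = written ?K (\<lambda>p. l p + r p + j) (\<lambda>p. arr ?s1 a_root (l p + ru) = 1 \<and> arr ?s1 a_root (r p + rv) = 1 \<or>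
      arr ?s1 a_root (l p + ru) = 1 \<and> arr ?s1 a_none (r p + rv) = 1) (arr ?s1 a_root) \<and>
    arr s' a_none = written ?K (\<lambda>p. l p + r p + j) (\<lambda>p. arr ?s1 a_none (l p + ru) = 1 \<and>
      arr ?s1 a_none (r p + rv) = 1) (arr ?s1 a_none) \<and>
    arr s' a_some = written ?K (\<lambda>p. l p + r p + j) (\<lambda>p. arr ?s1 a_some (l p + ru) = 1 \<and> arr ?s1 a_none (r p + rv) = 1 \<or>
      arr ?s1 a_none (l p + ru) = 1 \<and> arr ?s1 a_some (r p + rv) = 1 \<or>
      arr ?s1 a_root (l p + ru) = 1 \<and> arr ?s1 a_root (r p + rv) = 1) (arr ?s1 a_some) \<and>
    frame {r_p, r_x, r_y, r_d, 20, 21, 22, 23, 24, 25} {a_root, a_none, a_some} ?s1 s' \<and>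
    t \<le> 32 * ?K + 2) ?s1" (is "wp w _ ?Q _")
  proof (rule wp_merge_rows)
    \<comment> \<open>The two rows read are older than the row written, so the addresses differ
      modulo \<open>2 * n\<close>.\<close>
    fix p q assume pq: "p < ?K" "q < ?K"
    obtain e f where e: "l p = 2 * n * e" "r p = 2 * n * f" using code[OF pq(1)] by blast
    obtain e' f' where e': "l q = 2 * n * e'" "r q = 2 * n * f'" using code[OF pq(2)] by blast
    have "l q + r q + j = j + 2 * n * (e' + f')" using e' by (simp add: distrib_left)
    moreover have "l p + ru = ru + 2 * n * e" "r p + rv = rv + 2 * n * f" using e by simp_all
    moreover have "ru < 2 * n" "rv < 2 * n" using rj jn by simp_all
    ultimately show "l p + ru \<noteq> l q + r q + j \<and> r p + rv \<noteq> l q + r q + j"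
      using row_address_eq_iff[OF _ jn] rj by (metis less_irrefl)
  next
    fix p assume "p < ?K"
    from code[OF this] show "l p + ru < 2 ^ w \<and> r p + rv < 2 ^ w \<and> l p + r p + j < 2 ^ w"
      using rj jn by auto
  qed (use sreg Kw in \<open>auto simp: l_def r_def j_def\<close>)
  then have merged: "wp w (For r_p r_pairs merge_step) ?Q ?s1" .
  have "arr s a_nbs u < n" using d u n_pos by (simp add: degrees_ok_def)
  have "wp w (For r_p r_pairs merge_step ;; remove_leaf) (\<lambda>t s'. \<exists>u. neighbours E v \<inter> R = {u} \<and>
     tables_ok (R - {v}) (bag(u := bag u \<union> bag v)) s' \<and> degrees_ok (R - {v}) s' \<and>
     reg s' r_v = u \<and> reg s' r_next = Suc (reg s r_next) \<and> 3 + t \<le> 52 * 3 ^ L) ?s1"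
  proof (rule wp_SeqI[OF merged], elim conjE)
    fix t2 :: nat and s2
    assume tabs: "arr s2 a_root = written ?K (\<lambda>p. l p + r p + j) (\<lambda>p. arr ?s1 a_root (l p + ru) = 1 \<and> arr ?s1 a_root (r p + rv) = 1 \<or>
      arr ?s1 a_root (l p + ru) = 1 \<and> arr ?s1 a_none (r p + rv) = 1) (arr ?s1 a_root)"
      "arr s2 a_none = written ?K (\<lambda>p. l p + r p + j) (\<lambda>p. arr ?s1 a_none (l p + ru) = 1 \<and>
      arr ?s1 a_none (r p + rv) = 1) (arr ?s1 a_none)"
      "arr s2 a_some = written ?K (\<lambda>p. l p + r p + j) (\<lambda>p. arr ?s1 a_some (l p + ru) = 1 \<and> arr ?s1 a_none (r p + rv) = 1 \<or>
      arr ?s1 a_none (l p + ru) = 1 \<and> arr ?s1 a_some (r p + rv) = 1 \<or>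
      arr ?s1 a_root (l p + ru) = 1 \<and> arr ?s1 a_root (r p + rv) = 1) (arr ?s1 a_some)"
      and fr: "frame {r_p, r_x, r_y, r_d, 20, 21, 22, 23, 24, 25} {a_root, a_none, a_some} ?s1 s2"
      and t2: "t2 \<le> 32 * ?K + 2"
    have s2: "reg s2 one = 1" "reg s2 zero = 0" "reg s2 r_n = n" "reg s2 r_u = u" "reg s2 r_v = v"
        "reg s2 r_next = j" "arr s2 a_row = arr s a_row" "arr s2 a_deg = arr s a_deg" "arr s2 a_nbs = arr s a_nbs"
      using sreg v(1) by (simp_all add: frame_reg[OF fr] frame_arr[OF fr] j_def)
    have bounds: "Suc j < 2 ^ w" "arr s2 a_nbs u < n"
      using jn nw s2 \<open>arr s a_nbs u < n\<close> by simp_all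
    show "wp w remove_leaf (\<lambda>t s'. \<exists>u. neighbours E v \<inter> R = {u} \<and>
       tables_ok (R - {v}) (bag(u := bag u \<union> bag v)) s' \<and> degrees_ok (R - {v}) s' \<and>
       reg s' r_v = u \<and> reg s' r_next = Suc (reg s r_next) \<and> 3 + (t2 + t) \<le> 52 * 3 ^ L) s2"
    proof (rule wp_mono[OF wp_remove_leaf[OF s2(1-5) u(2) s2(6) bounds nw]], elim conjE)
      fix t :: nat and s'
      assume t: "t \<le> 14" and fr': "frame {r_next, r_x, r_v} {a_row, a_deg, a_nbs} s2 s'"
        and s': "reg s' r_next = Suc j" "reg s' r_v = u" "arr s' a_row = (arr s2 a_row)(u := j)"
        "arr s' a_deg = (arr s2 a_deg)(v := 0, u := arr s2 a_deg u - 1)"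
        "arr s' a_nbs = (arr s2 a_nbs)(u := (arr s2 a_nbs u + n - v) mod n)"
      have tabs': "arr s' a_root = arr s2 a_root" "arr s' a_none = arr s2 a_none" "arr s' a_some = arr s2 a_some"
        by (simp_all add: frame_arr[OF fr'])
      show "\<exists>u. neighbours E v \<inter> R = {u} \<and>
       tables_ok (R - {v}) (bag(u := bag u \<union> bag v)) s' \<and> degrees_ok (R - {v}) s' \<and>
       reg s' r_v = u \<and> reg s' r_next = Suc (reg s r_next) \<and> 3 + (t2 + t) \<le> 52 * 3 ^ L"
      proof (intro exI[of _ u] conjI)
        show "tables_ok (R - {v}) (bag(u := bag u \<union> bag v)) s'"
          by (rule tables_ok_merge[OF b tb v(2) nb lr j_def[symmetric] ru_def[symmetric] rv_def[symmetric]
                tabs(1)[folded tabs'(1), unfolded arr_set_reg] tabs(2)[folded tabs'(2), unfolded arr_set_reg]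
                tabs(3)[folded tabs'(3), unfolded arr_set_reg] s'(3)[unfolded s2] s'(1)])
        show "degrees_ok (R - {v}) s'"
          by (rule degrees_ok_remove[OF d R v(2) nb s'(4,5)[unfolded s2]])
        show "3 + (t2 + t) \<le> 52 * 3 ^ L"
          using t t2 one_le_power[of "3 :: nat" L] by linarith
      qed (use nb s' j_def in auto)
    qed
  qed
  then show ?thesis
    using v(1) nbs by (simp add: eliminate_def ru_def rv_def numeral_3_eq_3)
qed

section \<open>Start, invariant and end of the stripping loop\<close>

lemma tables_ok_init:
  assumes "reg s r_next = n" "arr s a_root = (\<lambda>x. of_bool (x < n))" "arr s a_some = (\<lambda>x. of_bool (x < n))"
    "\<forall>v<n. arr s a_row v = v"
    "arr s a_none = (\<lambda>x. of_bool (\<exists>v<n. \<exists>i<L. x = 2 * n * 2 ^ i + v \<and> tok i = \<chi> v))"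
  shows "tables_ok {..<n} (\<lambda>v. {v}) s"
proof -
  \<comment> \<open>The addresses below \<open>n\<close> are the entries of the empty token set in
    the first \<open>n\<close> rows, which are the root and some bits set by
    \<open>init_row\<close>.\<close>
  have lt: "j + 2 * n * set_encode m < n \<longleftrightarrow> j < n \<and> m = {}" if "m \<subseteq> {..<L}" for j m
  proof -
    have "finite m" using that finite_subset by blast
    then have "set_encode m = 0 \<longleftrightarrow> m = {}" using set_encode_eq_iff[of m "{}"] by simp
    then show ?thesis by (cases "set_encode m") auto
  qed
  \<comment> \<open>Deleting a single vertex takes exactly one token of its color, and
    \<open>{i}\<close> is coded by \<open>2 ^ i\<close>.\<close>
  have none: "(\<exists>v<n. \<exists>i<L. j + 2 * n * set_encode m = 2 * n * 2 ^ i + v \<and> tok i = \<chi> v) \<longleftrightarrow>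
      j < n \<and> none_kept {j} m" if m: "m \<subseteq> {..<L}" and j: "j < 2 * n" for j m
  proof -
    have fin: "finite m" using m finite_subset by blast
    have "j + 2 * n * set_encode m = 2 * n * 2 ^ i + v \<longleftrightarrow> j = v \<and> m = {i}" if "v < n" for i v
    proof -
      have "j + 2 * n * set_encode m = v + 2 * n * 2 ^ i \<longleftrightarrow> j = v \<and> set_encode m = 2 ^ i"
        by (rule row_address_eq_iff) (use j that in auto)
      moreover have "set_encode m = 2 ^ i \<longleftrightarrow> m = {i}"
        using set_encode_eq_iff[OF fin, of "{i}"] by (simp add: set_encode_insert)
      ultimately show ?thesis by (simp add: add.commute)
    qed
    then show ?thesis
      unfolding none_kept_singleton[OF fin] using m by auto
  qed
  have fin: "finite m" if "m \<subseteq> {..<L}" for m using that finite_subset by blast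
  show ?thesis
    unfolding tables_ok_def
  proof (intro conjI)
    show "\<forall>r\<in>{..<n}. arr s a_row r < reg s r_next \<and> row_ok s (arr s a_row r) {r} r"
      using assms lt none fin by (simp add: row_ok_def root_kept_singleton some_kept_singleton)
    show "\<forall>j. reg s r_next \<le> j \<longrightarrow> j < 2 * n \<longrightarrow> row_clear s j"
      using assms lt none by (simp add: row_clear_def)
    show "\<exists>r\<in>{..<n}. Suc (arr s a_row r) = reg s r_next"
      using assms n_pos by (intro bexI[of _ "n - 1"]) auto
  qed (use assms in simp)
qed

lemma bags_ok_init: "bags_ok {..<n} (\<lambda>v. {v})"
  using connE by (auto simp: bags_ok_def)

text \<open>The scan only ensures that no leaf is left; acyclicity and connectivity turn this into a
  single survivor.\<close>

lemma bags_ok_no_leaf: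
  assumes b: "bags_ok R bag" and "\<And>r. r \<in> R \<Longrightarrow> card (neighbours E r \<inter> R) \<noteq> 1"
  shows "\<exists>r. R = {r} \<and> bag r = {..<n}"
proof -
  have fin: "finite R" by (rule bags_ok_finite[OF b])
  have con: "cut_connected E R" and un: "\<Union>(bag ` R) = {..<n}" using b by (auto simp only: bags_ok_def)
  have "\<not> 2 \<le> card R"
  proof
    assume "2 \<le> card R"
    from cut_connected_acyclic_leaf[OF acyclicE symE irreflE fin this con]
    obtain v where v: "v \<in> R" "card {y \<in> R. (v, y) \<in> E} = 1" by blast
    moreover have "{y \<in> R. (v, y) \<in> E} = neighbours E v \<inter> R" by (auto simp: neighbours_def)
    ultimately show False using assms(2) by simp
  qed
  moreover have "card R \<noteq> 0" using con fin by (simp add: cut_connected_def)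
  ultimately have "card R = 1" by linarith
  then obtain r where "R = {r}" by (rule card_1_singletonE)
  then show ?thesis using un by simp
qed

text \<open>Among the vertices up to the scan position, only the vertex \<open>r_v\<close> under
  treatment may be a leaf. At the end \<open>r_v = n\<close> is not a vertex, so this exception is
  void.\<close>

definition strip_inv :: "nat \<Rightarrow> state \<Rightarrow> bool" where
  "strip_inv w s \<longleftrightarrow> static w s \<and> reg s r_i \<le> n \<and> (if reg s r_i < n then reg s r_v < n else reg s r_v = n) \<and>
     (\<exists>R bag. bags_ok R bag \<and> tables_ok R bag s \<and> degrees_ok R s \<and>
        (\<forall>r\<in>R. r \<le> reg s r_i \<longrightarrow> r \<noteq> reg s r_v \<longrightarrow> card (neighbours E r \<inter> R) \<noteq> 1))"

lemma static_frame:
  assumes "static w s" "frame X A s s'" "X \<inter> {one, zero, r_n, r_pairs} = {}" "A \<inter> {a_left, a_right} = {}"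
  shows "static w s'"
  using assms by (auto simp: static_def frame_def pair_set_def)

lemma tables_degrees_cong:
  assumes "reg s' r_next = reg s r_next" "arr s' = arr s"
  shows "tables_ok R bag s' \<longleftrightarrow> tables_ok R bag s" "degrees_ok R s' \<longleftrightarrow> degrees_ok R s"
  using assms by (simp_all add: tables_ok_def row_ok_def row_clear_def degrees_ok_def)

text \<open>
  In the potential, \<open>2 * n - r_next\<close> is the number of surviving vertices: the rows below \<open>n\<close> belong to
  single vertices, and every merge uses up one row.
\<close>

lemma wp_strip_step:
  assumes inv: "strip_inv w s" and i: "reg s r_i < n"
  shows "wp w strip_step (\<lambda>t s'. strip_inv w s' \<and>
     t + 1 + (60 * 3 ^ L * (2 * n - reg s' r_next) + 10 * (n - reg s' r_i)) \<le>
     60 * 3 ^ L * (2 * n - reg s r_next) + 10 * (n - reg s r_i)) s"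
proof -
  from inv obtain R bag where st: "static w s" and vn: "reg s r_v < n"
    and b: "bags_ok R bag" and t: "tables_ok R bag s" and d: "degrees_ok R s"
    and noleaf: "\<And>r. r \<in> R \<Longrightarrow> r \<le> reg s r_i \<Longrightarrow> r \<noteq> reg s r_v \<Longrightarrow> card (neighbours E r \<inter> R) \<noteq> 1"
    using i unfolding strip_inv_def by auto
  define v where "v = reg s r_v"
  define s1 where "s1 = set_reg r_x (arr s a_deg v) s"
  have st1: "static w s1" using st by (simp add: s1_def static_def)
  have tb1: "tables_ok R bag s1" and dg1: "degrees_ok R s1"
    using t d by (simp_all add: s1_def tables_degrees_cong[of "set_reg r_x (arr s a_deg v) s" s])
  have deg: "arr s a_deg v = (if v \<in> R then card (neighbours E v \<inter> R) else 0)"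
    using d vn by (simp add: degrees_ok_def v_def)
  have one: "reg s one = 1" using st by (simp add: static_def)
  show ?thesis
  proof (cases "arr s a_deg v = 1")
    case True
    then have vR: "v \<in> R" using deg by (auto split: if_splits)
    have "wp w eliminate (\<lambda>t s'. strip_inv w s' \<and>
       2 + t + 1 + (60 * 3 ^ L * (2 * n - reg s' r_next) + 10 * (n - reg s' r_i)) \<le>
       60 * 3 ^ L * (2 * n - reg s r_next) + 10 * (n - reg s r_i)) s1"
    proof (rule wp_mono[OF wp_frame[OF wp_eliminate[OF st1 b tb1 dg1, of v]]])
      show "reg s1 r_v = v" "v \<in> R" "arr s1 a_deg v = 1" using vR True by (simp_all add: s1_def v_def)
    next
      fix t' :: nat and s'
      assume "(\<exists>u. neighbours E v \<inter> R = {u} \<and>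
         tables_ok (R - {v}) (bag(u := bag u \<union> bag v)) s' \<and> degrees_ok (R - {v}) s' \<and>
         reg s' r_v = u \<and> reg s' r_next = Suc (reg s1 r_next) \<and> t' \<le> 52 * 3 ^ L) \<and>
         frame (regs_written eliminate) (arrs_written eliminate) s1 s'"
      then obtain u where nb: "neighbours E v \<inter> R = {u}"
        and t': "tables_ok (R - {v}) (bag(u := bag u \<union> bag v)) s'" and d': "degrees_ok (R - {v}) s'"
        and s': "reg s' r_v = u" "reg s' r_next = Suc (reg s1 r_next)" and time: "t' \<le> 52 * 3 ^ L"
        and fr: "frame (regs_written eliminate) (arrs_written eliminate) s1 s'" by blast
      have i': "reg s' r_i = reg s r_i"
        using fr by (simp add: frame_def eliminate_def merge_step_def merge_stores_def store_and_def reduce_def remove_leaf_def s1_def)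
      have st': "static w s'"
        by (rule static_frame[OF st1 fr])
          (simp_all add: eliminate_def merge_step_def merge_stores_def store_and_def reduce_def remove_leaf_def)
      have b': "bags_ok (R - {v}) (bag(u := bag u \<union> bag v))" by (rule bags_ok_merge[OF b vR nb])
      have un: "u < n" using nb b by (auto simp: bags_ok_def)
      \<comment> \<open>Removing \<open>v\<close> changes the degree of \<open>u\<close> only, and
        \<open>u\<close> is the new exception.\<close>
      have "card (neighbours E r \<inter> (R - {v})) \<noteq> 1"
        if r: "r \<in> R - {v}" "r \<le> reg s r_i" "r \<noteq> u" for r
      proof -
        have "r \<notin> neighbours E v" using nb r by blast
        then have "v \<notin> neighbours E r" using symE by (auto simp: neighbours_def dest: symD)
        then have "neighbours E r \<inter> (R - {v}) = neighbours E r \<inter> R" by blast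
        then show ?thesis using noleaf[of r] r by (simp add: v_def)
      qed
      then have inv': "strip_inv w s'"
        unfolding strip_inv_def using st' i' i s' un t' d' b'
        by (intro conjI exI[of _ "R - {v}"] exI[of _ "bag(u := bag u \<union> bag v)"]) auto
      \<comment> \<open>The subtraction in the potential is truncated; as \<open>r_next\<close>
        stays within \<open>2 * n\<close>, the difference really drops by one and releases
        \<open>60 * 3 ^ L\<close>.\<close>
      have "reg s' r_next \<le> 2 * n" using t' by (simp add: tables_ok_def)
      then obtain k where k: "2 * n - reg s r_next = Suc k" "2 * n - reg s' r_next = k"
        using s' by (cases "2 * n - reg s r_next") (auto simp: s1_def)
      have "2 + t' + 1 \<le> 60 * 3 ^ L" using time one_le_power[of "3 :: nat" L] by linarith
      then show "strip_inv w s' \<and>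
       2 + t' + 1 + (60 * 3 ^ L * (2 * n - reg s' r_next) + 10 * (n - reg s' r_i)) \<le>
       60 * 3 ^ L * (2 * n - reg s r_next) + 10 * (n - reg s r_i)"
        using inv' i' unfolding k by simp
    qed
    then show ?thesis
      using True one by (simp add: strip_step_def s1_def v_def)
  next
    case False
    let ?i = "Suc (reg s r_i)"
    let ?s' = "set_reg r_v ?i (set_reg r_i ?i s1)"
    \<comment> \<open>\<open>v\<close> ceases to be the exception because its degree has just been
      seen to differ from 1.\<close>
    have "card (neighbours E r \<inter> R) \<noteq> 1" if r: "r \<in> R" "r \<le> ?i" "r \<noteq> ?i" for r
    proof (cases "r = v")
      case True
      then show ?thesis using False deg r by auto
    next
      case False
      then show ?thesis using noleaf[of r] r by (simp add: v_def)
    qed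
    moreover have "tables_ok R bag ?s'" "degrees_ok R ?s'"
      using t d tables_degrees_cong[of ?s' s] by (simp_all add: s1_def)
    moreover have "static w ?s'" using st by (simp add: static_def pair_set_def s1_def)
    ultimately have inv': "strip_inv w ?s'"
      unfolding strip_inv_def using i b
      by (intro conjI exI[of _ R] exI[of _ bag]) auto
    have "?i < 2 ^ w"
    proof -
      have "n \<le> 3 ^ L * n" by simp
      then show ?thesis using st i unfolding static_def by linarith
    qed
    moreover have "10 * (n - ?i) + 10 = 10 * (n - reg s r_i)" using i by simp
    ultimately show ?thesis
      using False one inv' by (simp add: strip_step_def s1_def v_def)
  qed
qed

lemma wp_strip_leaves:
  assumes st: "static w s" and d: "degrees_ok {..<n} s"
    and t: "tables_ok {..<n} (\<lambda>v. {v}) (set_reg r_next n s)"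
  shows "wp w strip_leaves (\<lambda>t s'. (\<exists>j. reg s' r_next = Suc j \<and> j < 2 * n \<and>
       (\<forall>m\<subseteq>{..<L}. arr s' a_some (j + 2 * n * set_encode m) = of_bool (some_kept {..<n} m))) \<and>
     frame (regs_written strip_leaves) (arrs_written strip_leaves) s s' \<and>
     t \<le> 60 * 3 ^ L * n + 10 * n + 4) s"
proof -
  let ?s = "set_reg r_next n (set_reg r_v 0 (set_reg r_i 0 s))"
  let ?pot = "\<lambda>s. 60 * 3 ^ L * (2 * n - reg s r_next) + 10 * (n - reg s r_i)"
  have I0: "strip_inv w ?s"
  proof -
    have "tables_ok {..<n} (\<lambda>v. {v}) ?s"
      using t tables_degrees_cong(1)[of ?s "set_reg r_next n s"] by simp
    moreover have "degrees_ok {..<n} ?s" using d by (simp add: degrees_ok_def)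
    moreover have "static w ?s" using st by (simp add: static_def)
    ultimately show ?thesis
      unfolding strip_inv_def using n_pos bags_ok_init
      by (intro conjI exI[of _ "{..<n}"] exI[of _ "\<lambda>v. {v}"]) auto
  qed
  have "wp w (While (Lt r_i r_n) strip_step)
      (\<lambda>t s'. strip_inv w s' \<and> \<not> holds (Lt r_i r_n) s' \<and> t + ?pot s' \<le> ?pot ?s + 1) ?s"
  proof (rule wp_While[where I = "strip_inv w", OF I0])
    fix s assume "strip_inv w s" "holds (Lt r_i r_n) s"
    moreover then have "reg s r_i < n" by (simp add: strip_inv_def static_def)
    ultimately show "wp w strip_step (\<lambda>t s'. strip_inv w s' \<and> t + 1 + ?pot s' \<le> ?pot s) s"
      by (intro wp_strip_step)
  qed
  then have "wp w strip_leaves (\<lambda>t s'. strip_inv w s' \<and> \<not> holds (Lt r_i r_n) s' \<and>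
      t \<le> 60 * 3 ^ L * n + 10 * n + 4) s"
    using st unfolding strip_leaves_def
    by (auto simp: static_def elim!: wp_mono)
  then show ?thesis
  proof (rule wp_mono[OF wp_frame], elim conjE, intro conjI)
    fix t s' assume inv: "strip_inv w s'" and h: "\<not> holds (Lt r_i r_n) s'"
    then have i: "reg s' r_i = n" by (simp add: strip_inv_def static_def)
    from inv obtain R bag where b: "bags_ok R bag" and t: "tables_ok R bag s'"
      and noleaf: "\<And>r. r \<in> R \<Longrightarrow> r \<le> n \<Longrightarrow> r \<noteq> n \<Longrightarrow> card (neighbours E r \<inter> R) \<noteq> 1"
      unfolding strip_inv_def i by auto
    have "R \<subseteq> {..<n}" using b by (simp add: bags_ok_def)
    then obtain r where r: "R = {r}" "bag r = {..<n}"
      using bags_ok_no_leaf[OF b] noleaf by (metis lessThan_iff less_imp_le nat_neq_iff subsetD)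
    show "\<exists>j. reg s' r_next = Suc j \<and> j < 2 * n \<and>
       (\<forall>m\<subseteq>{..<L}. arr s' a_some (j + 2 * n * set_encode m) = of_bool (some_kept {..<n} m))"
      using t r by (intro exI[of _ "arr s' a_row r"]) (auto simp: tables_ok_def row_ok_def)
  qed
qed

end

section \<open>The complete program\<close>

context motif_tree
begin

text \<open>Spending all tokens deletes exactly the surplus, so what is kept has the colors
  \<open>M\<close>.\<close>

lemma some_kept_all_iff:
  assumes "tokens {..<L} = colors {..<n} - M" "M \<subseteq># colors {..<n}"
  shows "some_kept {..<n} {..<L} \<longleftrightarrow> (\<exists>S\<subseteq>{..<n}. cut_connected E S \<and> colors S = M)"
proof -
  have "colors ({..<n} - S) = tokens {..<L} \<longleftrightarrow> colors S = M" if "S \<subseteq> {..<n}" for S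
  proof -
    have "finite S" using that finite_subset by blast
    then have "colors {..<n} = colors S + colors ({..<n} - S)"
      using colors_Un[of S "{..<n} - S"] that by (simp add: Un_absorb1)
    moreover have "colors {..<n} = M + tokens {..<L}" using assms by simp
    ultimately show ?thesis by (metis add_left_cancel add_right_cancel)
  qed
  then show ?thesis unfolding some_kept_def by blast
qed

lemma wp_solve:
  assumes s: "reg s one = 1" "reg s zero = 0" "reg s r_n = n" "reg s r_l = L" "reg s r_edges = length es"
    and es: "\<And>i. i < length es \<Longrightarrow> arr s a_src i = fst (es ! i) \<and> arr s a_dst i = snd (es ! i)"
    and col: "\<And>v. v < n \<Longrightarrow> arr s a_color v = \<chi> v" and tok: "arr s a_token = tok"
    and z: "\<And>a. a \<in> {a_left, a_right, a_root, a_none, a_some, a_deg, a_nbs} \<Longrightarrow> arr s a = (\<lambda>_. 0)"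
    and dist: "distinct es" "set es \<inter> (set es)\<inverse> = {}" and sub: "set es \<subseteq> {..<n} \<times> {..<n}"
    and E: "E = set es \<union> (set es)\<inverse>" and len: "length es \<le> n"
    and bnd: "4 * (3 ^ L * n) < 2 ^ w"
  shows "wp w (build_pairs ;; init_rows ;; read_edges ;; strip_leaves ;; answer)
    (\<lambda>t s'. reg s' 0 = of_bool (some_kept {..<n} {..<L}) \<and> t \<le> 140 * (3 ^ L * n)) s"
proof -
  let ?N = "3 ^ L * n"
  \<comment> \<open>This absorbs the \<open>n * L\<close> token comparisons of
    \<open>init_rows\<close>.\<close>
  have L3: "L < 3 ^ L" using less_exp[of L] power_mono[of 2 "3::nat" L] by linarith
  then have "L * n \<le> ?N" by simp
  then have big: "n \<le> ?N" "3 ^ L \<le> ?N" "n * L \<le> ?N" "1 \<le> ?N"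
    using n_pos by (simp_all add: mult.commute)
  have nw: "n < 2 ^ w" "2 * n < 2 ^ w" "L < 2 ^ w" "length es < 2 ^ w"
    using big bnd L3 len by linarith+
  have z0: "arr s a_left 0 = 0" "arr s a_right 0 = 0" using z by simp_all
  show ?thesis
  proof (rule wp_SeqI[OF wp_build_pairs[OF s(1,3,4) n_pos bnd z0]], elim conjE)
    fix t1 :: nat and s1
    assume s1: "reg s1 r_pairs = 3 ^ L" "pair_set s1 (3 ^ L) = pair_codes (2 * n) L"
        "reg s1 r_stride = 2 * n" "reg s1 r_weight = 2 * n * 2 ^ L"
        "\<forall>i<L. arr s1 a_weight i = 2 * n * 2 ^ i"
      and f1: "frame {r_i, r_p, r_u, r_x, r_y, r_d, r_pairs, r_weight, r_stride} {a_left, a_right, a_weight} s s1"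
      and t1: "t1 \<le> 20 * 3 ^ L"
    have r1: "reg s1 one = 1" "reg s1 zero = 0" "reg s1 r_n = n" "reg s1 r_l = L" "reg s1 r_edges = length es"
      using s by (simp_all add: frame_reg[OF f1])
    have a1: "arr s1 a_src = arr s a_src" "arr s1 a_dst = arr s a_dst" "arr s1 a_color = arr s a_color" "arr s1 a_token = tok"
        "arr s1 a_root = (\<lambda>_. 0)" "arr s1 a_none = (\<lambda>_. 0)" "arr s1 a_some = (\<lambda>_. 0)"
        "arr s1 a_deg = (\<lambda>_. 0)" "arr s1 a_nbs = (\<lambda>_. 0)"
      using z tok by (simp_all add: frame_arr[OF f1])
    have wt: "arr s1 a_weight i + v < 2 ^ w" if "i < L" "v < n" for i v
    proof -
      have "2 * n * 2 ^ i \<le> 2 * n * 2 ^ L" using that by (simp add: power_increasing)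
      moreover have "arr s1 a_weight i = 2 * n * 2 ^ i" using s1(5) that by simp
      ultimately show ?thesis using that(2) pow_bound bnd big(1) by linarith
    qed
    show "wp w (init_rows ;; read_edges ;; strip_leaves ;; answer) (\<lambda>t s'.
      reg s' 0 = of_bool (some_kept {..<n} {..<L}) \<and> t1 + t \<le> 140 * ?N) s1"
    proof (rule wp_SeqI[OF wp_init_rows[OF r1(1,3,4) nw(3,1) wt a1(5-7)]], assumption, assumption, elim conjE)
      fix t2 :: nat and s2
      assume s2: "arr s2 a_root = (\<lambda>x. of_bool (x < n))" "arr s2 a_some = (\<lambda>x. of_bool (x < n))"
          "\<forall>v<n. arr s2 a_row v = v"
          "arr s2 a_none = (\<lambda>x. of_bool (\<exists>v<n. \<exists>i<L. x = arr s1 a_weight i + v \<and> arr s1 a_token i = arr s1 a_color v))"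
        and f2: "frame {r_i, r_v, r_p, r_x, r_d} {a_root, a_some, a_none, a_row} s1 s2"
        and t2: "t2 \<le> n * (8 + 7 * L) + 2"
      have r2: "reg s2 one = 1" "reg s2 zero = 0" "reg s2 r_n = n" "reg s2 r_edges = length es"
          "reg s2 r_pairs = 3 ^ L" "reg s2 r_stride = 2 * n" "reg s2 r_weight = 2 * n * 2 ^ L"
        using r1 s1 by (simp_all add: frame_reg[OF f2])
      have p2: "pair_set s2 (3 ^ L) = pair_codes (2 * n) L"
        using s1(2) by (simp add: pair_set_def frame_arr[OF f2])
      have a2: "arr s2 a_deg = (\<lambda>_. 0)" "arr s2 a_nbs = (\<lambda>_. 0)"
        using a1 by (simp_all add: frame_arr[OF f2])
      have es2: "arr s2 a_src i = fst (es ! i) \<and> arr s2 a_dst i = snd (es ! i)" if "i < length es" for i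
        using es[OF that] a1 by (simp add: frame_arr[OF f2])
      have none: "arr s2 a_none = (\<lambda>x. of_bool (\<exists>v<n. \<exists>i<L. x = 2 * n * 2 ^ i + v \<and> tok i = \<chi> v))"
        unfolding s2(4) a1 using s1(5) col by (simp cong: conj_cong)
      show "wp w (read_edges ;; strip_leaves ;; answer) (\<lambda>t s'.
        reg s' 0 = of_bool (some_kept {..<n} {..<L}) \<and> t1 + (t2 + t) \<le> 140 * ?N) s2"
      proof (rule wp_SeqI[OF wp_read_edges[OF r2(1,3,4) nw(4,2) es2 a2 dist sub]], assumption, elim conjE)
        fix t3 :: nat and s3
        assume s3: "arr s3 a_deg = (\<lambda>v. card (neighbours (set es \<union> (set es)\<inverse>) v))"
            "arr s3 a_nbs = (\<lambda>v. \<Sum>(neighbours (set es \<union> (set es)\<inverse>) v) mod n)"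
          and f3: "frame {r_i, r_u, r_v, r_x} {a_deg, a_nbs} s2 s3" and t3: "t3 \<le> 20 * length es + 2"
        have r3: "reg s3 one = 1" "reg s3 zero = 0" "reg s3 r_n = n"
            "reg s3 r_pairs = 3 ^ L" "reg s3 r_stride = 2 * n" "reg s3 r_weight = 2 * n * 2 ^ L"
          using r2 by (simp_all add: frame_reg[OF f3])
        have "pair_set s3 (3 ^ L) = pair_codes (2 * n) L"
          using p2 by (simp add: pair_set_def frame_arr[OF f3])
        then have st: "static w s3" using r3 bnd by (simp add: static_def)
        have nb: "neighbours E v \<inter> {..<n} = neighbours E v" for v
          using sub by (auto simp: neighbours_def E)
        have dg: "degrees_ok {..<n} s3"
          by (simp add: degrees_ok_def nb s3 E[symmetric])
        have tb: "tables_ok {..<n} (\<lambda>v. {v}) (set_reg r_next n s3)"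
          by (rule tables_ok_init) (use s2 none in \<open>simp_all add: frame_arr[OF f3]\<close>)
        show "wp w (strip_leaves ;; answer) (\<lambda>t s'.
          reg s' 0 = of_bool (some_kept {..<n} {..<L}) \<and> t1 + (t2 + (t3 + t)) \<le> 140 * ?N) s3"
        proof (rule wp_SeqI[OF wp_strip_leaves[OF st dg tb]], elim conjE exE)
          fix t4 :: nat and s4 j
          assume j: "reg s4 r_next = Suc j" "j < 2 * n"
            and row: "\<forall>m\<subseteq>{..<L}. arr s4 a_some (j + 2 * n * set_encode m) = of_bool (some_kept {..<n} m)"
            and f4: "frame (regs_written strip_leaves) (arrs_written strip_leaves) s3 s4"
            and t4: "t4 \<le> 60 * 3 ^ L * n + 10 * n + 4"
          have r4: "reg s4 one = 1" "reg s4 r_stride = 2 * n" "reg s4 r_weight = 2 * n * 2 ^ L"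
            using f4 r3 by (simp_all add: frame_def strip_leaves_def strip_step_def eliminate_def
                merge_step_def merge_stores_def store_and_def reduce_def remove_leaf_def)
          have addr: "j + (2 * n * 2 ^ L - 2 * n) = j + 2 * n * set_encode {..<L}"
            by (simp add: set_encode_lessThan diff_mult_distrib2)
          have "j + (2 * n * 2 ^ L - 2 * n) < 2 ^ w"
          proof -
            have "2 * n \<le> 2 * n * 2 ^ L" by simp
            then show ?thesis using j(2) pow_bound bnd by linarith
          qed
          moreover have "arr s4 a_some (j + (2 * n * 2 ^ L - 2 * n)) = of_bool (some_kept {..<n} {..<L})"
            unfolding addr using row by simp
          moreover have "n * (8 + 7 * L) = 8 * n + 7 * (n * L)" by (simp add: algebra_simps)
          \<comment> \<open>In multiples of \<open>?N\<close>, the five phases cost at most 20, 17,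
            22, 74 and 4.\<close>
          then have "t1 + (t2 + (t3 + (t4 + 4))) \<le> 140 * ?N"
            using t1 t2 t3 t4 big len by linarith
          ultimately show "wp w answer (\<lambda>t s'. reg s' 0 = of_bool (some_kept {..<n} {..<L}) \<and>
              t1 + (t2 + (t3 + (t4 + t))) \<le> 140 * ?N) s4"
            using j r4 by (simp add: answer_def)
        qed
      qed
    qed
  qed
qed

end

section \<open>From trees and motifs to cuts and tokens\<close>

lemma graph_motif_iff_cut_connected:
  assumes "pair_graph G"
  shows "graph_motif G \<chi> M \<longleftrightarrow>
    (\<exists>S\<subseteq>pverts G. cut_connected (parcs G) S \<and> image_mset \<chi> (mset_set S) = M)"
  unfolding graph_motif_def connected_induce_iff[OF assms] by blast

lemma undirected_tree_cut_connected:
  assumes "undirected_tree G" shows "cut_connected (parcs G) (pverts G)"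
proof -
  from assms have G: "pair_graph G" and con: "Digraph_Component.connected (with_proj G)"
    by (simp_all add: undirected_tree_def)
  interpret pair_graph G by fact
  have "with_proj G \<restriction> pverts G = with_proj G"
    using in_arcsD1 in_arcsD2 by (auto simp: induce_subgraph_def with_proj_def)
  then show ?thesis using connected_induce_iff[OF G, of "pverts G"] con by simp
qed

text \<open>Of the factor 200 in the time bound, at most 27 is spent up to the second test and at
  most 140 on the rest; what remains is slack.\<close>

lemma graph_motif_program_correct:
  assumes enc: "gm_encoding G \<chi> M n q es ms" and tree: "undirected_tree G"
    and l: "l = n - size M" and bnd: "200 * (3 ^ l * n + q + size M) \<le> 2 ^ w"
  shows "wp w graph_motif_program
    (\<lambda>t s. t \<le> 200 * (3 ^ l * n) \<and> reg s 0 = (if graph_motif G \<chi> M then 1 else 0)) (gm_input \<chi> n q es ms)"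
proof -
  have G: "pair_graph G" "pverts G = {..<n}" "distinct es" "set es \<inter> (set es)\<inverse> = {}"
    "parcs G = set es \<union> (set es)\<inverse>" "mset ms = M"
    using enc by (simp_all add: gm_encoding_def)
  interpret G: pair_graph G by (rule G(1))
  let ?E = "parcs G"
  have symE: "sym ?E" unfolding G(5) by (auto simp: sym_def)
  have irr: "irrefl ?E" using G.no_loops' by (metis irreflI)
  have acyc: "acyclic_graph ?E" by (rule undirected_tree_acyclic[OF tree])
  have con: "cut_connected ?E {..<n}" using undirected_tree_cut_connected[OF tree] G(2) by simp
  then have n: "0 < n" by (cases n) (auto simp: cut_connected_def)
  have subE: "?E \<subseteq> {..<n} \<times> {..<n}"
    using G.in_arcsD1 G.in_arcsD2 unfolding G(2) by auto
  then have sub: "set es \<subseteq> {..<n} \<times> {..<n}" using G(5) by blast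
  have len: "length es \<le> n"
  proof -
    have "2 * length es = card ?E"
      unfolding G(5) using G(3,4) by (simp add: card_Un_disjoint distinct_card)
    also have "?E = ?E \<inter> {..<n} \<times> {..<n}" using subE by blast
    also have "card \<dots> \<le> 2 * card {..<n}"
      by (rule acyclic_graph_card_edges[OF acyc symE irr]) simp
    finally show ?thesis by simp
  qed
  have lms: "length ms = size M" using G(6) by (metis size_mset)
  let ?V = "image_mset \<chi> (mset_set {..<n})"
  have motif: "graph_motif G \<chi> M \<longleftrightarrow> (\<exists>S\<subseteq>{..<n}. cut_connected ?E S \<and> image_mset \<chi> (mset_set S) = M)"
    using graph_motif_iff_cut_connected[OF G(1)] G(2) by metis
  have motif_sub: "M \<subseteq># ?V" if "graph_motif G \<chi> M"
    using that unfolding motif by (auto intro!: image_mset_subseteq_mono subset_imp_msubset_mset_set)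
  have n3: "n \<le> 3 ^ l * n" by simp
  have bnd': "200 * (3 ^ l * n) + 200 * q + 200 * size M \<le> 2 ^ w"
    using bnd by (simp only: distrib_left)
  let ?s0 = "gm_input \<chi> n q es ms"
  let ?s = "set_reg one 1 ?s0"
  have s0: "reg ?s0 r_n = n" "reg ?s0 r_edges = length es" "reg ?s0 r_motif = length ms" "reg ?s0 zero = 0" "reg ?s0 r_l = 0"
    by (simp_all add: gm_input_def list_array_def nth_Cons')
  have arrs: "arr ?s0 a_src = list_array (map fst es)" "arr ?s0 a_dst = list_array (map snd es)"
     "arr ?s0 a_color = list_array (map \<chi> [0..<n])" "arr ?s0 a_motif = list_array ms"
    and arr0: "\<And>a. 4 \<le> a \<Longrightarrow> arr ?s0 a = (\<lambda>_. 0)"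
    by (simp_all add: gm_input_def)
  have one_w: "1 < (2 :: nat) ^ w" using bnd' n n3 by linarith
  have msw: "size M < 2 ^ w" using bnd' n n3 by linarith
  let ?Q = "\<lambda>t s. t \<le> 200 * (3 ^ l * n) \<and> reg s 0 = (if graph_motif G \<chi> M then 1 else 0 :: nat)"
  show ?thesis
  proof (cases "n < length ms")
    case True
    then have "\<not> M \<subseteq># ?V" using size_mset_mono[of M ?V] lms by auto
    then have "\<not> graph_motif G \<chi> M" using motif_sub by blast
    then show ?thesis
      using True s0 one_w by (simp add: graph_motif_program_def) (use n n3 in linarith)
  next
    case False
    have "wp w (count_motif ;; collect_tokens ;; Add r_x r_l r_motif ;;
        If (Eq r_x r_n)
          (build_pairs ;; init_rows ;; read_edges ;; strip_leaves ;; answer)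
          (Const 0 0)) (\<lambda>t. ?Q (2 + t)) ?s"
    proof (rule wp_SeqI[OF wp_count_motif[of ?s ms]], goal_cases)
      case (6 t1 s1)
      then have s1: "arr s1 a_count = count M" and f1: "frame {r_i, r_x, r_y} {a_count} ?s s1"
        and t1: "t1 \<le> 6 * length ms + 2" using G(6) by simp_all
      have r1: "reg s1 one = 1" "reg s1 zero = 0" "reg s1 r_n = n" "reg s1 r_l = 0"
        using s0 by (simp_all add: frame_reg[OF f1])
      have c1: "arr s1 a_color v = \<chi> v" if "v < n" for v
        using that arrs by (simp add: frame_arr[OF f1] list_array_def)
      have nw: "n < 2 ^ w" using bnd' n3 n by linarith
      show ?case
      proof (rule wp_SeqI[OF wp_collect_tokens[OF r1(1-3) nw c1 s1 r1(4)]], assumption, elim conjE)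
        fix t2 :: nat and s2
        assume tok: "image_mset (arr s2 a_token) (mset_set {..<reg s2 r_l}) = ?V - M"
          and Ln: "reg s2 r_l \<le> n"
          and f2: "frame {r_i, r_x, r_y, r_l} {a_count, a_token} s1 s2" and t2: "t2 \<le> 7 * n + 2"
        define L where "L = reg s2 r_l"
        define s3 where "s3 = set_reg r_x (L + length ms) s2"
        have r2: "reg s2 one = 1" "reg s2 zero = 0" "reg s2 r_n = n" "reg s2 r_motif = length ms"
            "reg s2 r_edges = length es"
          using r1 s0 by (simp_all add: frame_reg[OF f2] frame_reg[OF f1])
        have sizeL: "size (?V - M) = L" unfolding tok[symmetric] L_def by simp
        have sum_w: "L + length ms < 2 ^ w" using Ln False bnd' n3 n unfolding L_def by linarith
        have time: "2 + (t1 + (t2 + 2)) \<le> 27 * (3 ^ l * n)"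
          using t1 t2 False n3 n by linarith
        have "wp w (If (Eq r_x r_n)
          (build_pairs ;; init_rows ;; read_edges ;; strip_leaves ;; answer)
          (Const 0 0)) (\<lambda>t. ?Q (2 + (t1 + (t2 + (1 + t))))) s3"
        proof (cases "L + length ms = n")
          case True
          \<comment> \<open>The surplus has \<open>n - size (?V \<inter># M)\<close> elements, so
            the test forces the intersection to be as large as \<open>M\<close>.\<close>
          have "size (?V \<inter># M) = size M"
            using size_Diff_subset_Int[of ?V M] size_mset_mono[of "?V \<inter># M" ?V] sizeL True lms
            by (simp add: True[symmetric])
          then have "?V \<inter># M = M"
            using mset_subset_size[of "?V \<inter># M" M] by (auto simp: subset_mset.less_le)
          then have MV: "M \<subseteq># ?V" by (metis subset_mset.inf.cobounded1)
          \<comment> \<open>Only for a contained motif does the number of tokens equal the parameter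
            \<open>l\<close>; otherwise it is larger, but then no table is built.\<close>
          have Ll: "L = l" using True l lms by simp
          interpret motif_tree ?E \<chi> "arr s2 a_token" n L
            using symE irr acyc con by unfold_locales
          have iff: "some_kept {..<n} {..<L} \<longleftrightarrow> graph_motif G \<chi> M"
            using some_kept_all_iff[of M] tok MV unfolding motif tokens_def colors_def L_def by simp
          have 4: "4 * (3 ^ L * n) < 2 ^ w" using bnd' n n3 unfolding Ll by linarith
          have "wp w (build_pairs ;; init_rows ;; read_edges ;; strip_leaves ;; answer)
              (\<lambda>t s'. reg s' 0 = of_bool (some_kept {..<n} {..<L}) \<and> t \<le> 140 * (3 ^ L * n)) s3"
          proof (rule wp_solve[where es = es])
            show "arr s3 a = (\<lambda>_. 0)" if "a \<in> {a_left, a_right, a_root, a_none, a_some, a_deg, a_nbs}" for a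
              using that arr0[of a] by (auto simp: s3_def frame_arr[OF f2] frame_arr[OF f1])
          qed (use r2 arrs c1 G sub len 4 in
            \<open>simp_all add: s3_def L_def frame_arr[OF f2] frame_arr[OF f1] list_array_def\<close>)
          then have "wp w (build_pairs ;; init_rows ;; read_edges ;; strip_leaves ;; answer)
              (\<lambda>t. ?Q (2 + (t1 + (t2 + (1 + (1 + t)))))) s3"
            by (rule wp_mono) (use iff time Ll in auto)
          then show ?thesis using True r2 by (simp add: s3_def)
        next
          case neq: False
          have "\<not> M \<subseteq># ?V"
          proof
            assume "M \<subseteq># ?V"
            then have "L = n - size M" using sizeL size_Diff_submset[of M ?V] by simp
            then show False using neq False lms by simp
          qed
          then have "\<not> graph_motif G \<chi> M" using motif_sub by blast
          then show ?thesis using neq r2 by (simp add: s3_def) (use time n n3 in linarith)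
        qed
        then show "wp w (Add r_x r_l r_motif ;; If (Eq r_x r_n)
          (build_pairs ;; init_rows ;; read_edges ;; strip_leaves ;; answer)
          (Const 0 0)) (\<lambda>t. ?Q (2 + (t1 + (t2 + t)))) s2"
          using sum_w r2 by (simp add: s3_def L_def del: wp_If)
      qed
    qed (use s0 arrs arr0 msw lms in \<open>simp_all add: list_array_def\<close>)
    then show ?thesis
      using False s0 one_w by (simp add: graph_motif_program_def split del: if_split)
  qed
qed

theorem theorem7:
  shows "\<exists>(P :: com) (c :: nat).
    \<forall>(G :: nat pair_pre_digraph) (\<chi> :: nat \<Rightarrow> nat) (M :: nat multiset) (n :: nat) (q :: nat)
      (es :: (nat \<times> nat) list) (ms :: nat list) (l :: nat) (w :: nat).
      gm_encoding G \<chi> M n q es ms \<longrightarrow>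
      undirected_tree G \<longrightarrow>
      l = n - size M \<longrightarrow>
      c * (3 ^ l * n + q + size M) \<le> 2 ^ w \<longrightarrow>
      (\<exists>t s. exec w P (gm_input \<chi> n q es ms) t s \<and>
             t \<le> c * (3 ^ l * n) \<and>
             reg s 0 = (if graph_motif G \<chi> M then 1 else 0))"
  using graph_motif_program_correct unfolding wp_def
  by (intro exI[of _ graph_motif_program] exI[of _ 200]) blast

end
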